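(* Let $X=(X_1,\dots,X_N)$ be the queue length process with strictly positive arrival rates $\lambda_1,\dots,\lambda_N$ and bounded service rates $\phi_1,\dots,\phi_N:\mathbb{Z}_+^N\to\mathbb{R}_+$. Let $i\in\{1,\dots,N\}$. Then, regardless of the initial state of $X$, the process $X_i$ is stable if $$\lambda_i < \liminf_{x_i \to \infty} \ \inf_{x_j:\, j\neq i} \phi_i(x_1,\dots,x_N), \qquad ( * )$$ and transient if $$\lambda_i > \limsup_{x_i \to \infty} \ \sup_{x_j:\, j\neq i} \phi_i(x_1,\dots,x_N).$$ In particular, $X$ is stable if $( * )$ holds for all $i=1,\dots,N$.
   Context: $\mathbb{Z}_+=\{0,1,2,\dots\}$, $\mathbb{R}_+=[0,\infty)$, and $e_i$ is the $i$-th unit vector of $\mathbb{Z}_+^N$. In the infimum and supremum the variables $x_j$, $j\ne i$, range over $\mathbb{Z}_+$. Queue length process: given arrival rates $\lambda_i>0$ and a bounded function $\phi=(\phi_1,\dots,\phi_N):\mathbb{Z}_+^N\to\mathbb{R}_+^N$ (the service rates), $X$ is the continuous-time Markov process on $\mathbb{Z}_+^N$ (with right-continuous paths with left limits; it is nonexplosive because the rates are bounded) with transitions $x\mapsto x+e_i$ at rate $\lambda_i$ and $x\mapsto x-e_i$ at rate $\phi_i(x)1(x_i>0)$, $i=1,\dots,N$. A stochastic process $U$ with values in a countable space $S$ is stable if for every $\epsilon>0$ there is a finite set $K\subset S$ such that $\Pr(U(t)\notin K)\le\epsilon$ for all $t\ge0$. It is transient if $U(t)\to\infty$ almost surely, i.e.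 for every finite set $K\subset S$, $\Pr\big(\bigcup_{s\ge0}\bigcap_{t\ge s}\{U(t)\notin K\}\big)=1$. *)

theory Defs
  imports "HOL-Probability.Probability"
begin

text \<open>Continuous-time Markov processes on a countable set \<open>'s\<close>, described by the rates
  \<open>r x y\<close> of the transitions from \<open>x\<close> to \<open>y \<noteq> x\<close>. Processes are indexed by
  \<open>real\<close>, but only times \<open>t \<ge> 0\<close> are meaningful.\<close>

definition generator :: "('s \<Rightarrow> 's \<Rightarrow> real) \<Rightarrow> 's \<Rightarrow> 's \<Rightarrow> real" where
  "generator r x y = (if y = x then - (\<Sum>\<^sub>\<infinity>z\<in>-{x}. r x z) else r x y)"

text \<open>The second clause is the Chapman--Kolmogorov equation.\<close>

definition transition_semigroup :: "(real \<Rightarrow> 's \<Rightarrow> 's pmf) \<Rightarrow> bool" where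
  "transition_semigroup p \<longleftrightarrow>
     (\<forall>x. p 0 x = return_pmf x) \<and>
     (\<forall>s\<ge>0. \<forall>t\<ge>0. \<forall>x. p (s + t) x = bind_pmf (p s x) (p t))"

definition has_generator :: "(real \<Rightarrow> 's \<Rightarrow> 's pmf) \<Rightarrow> ('s \<Rightarrow> 's \<Rightarrow> real) \<Rightarrow> bool" where
  "has_generator p q \<longleftrightarrow>
     (\<forall>x y. ((\<lambda>t. pmf (p t x) y) has_real_derivative q x y) (at_right 0))"

definition markov_with ::
    "'w measure \<Rightarrow> (real \<Rightarrow> 's \<Rightarrow> 's pmf) \<Rightarrow> (real \<Rightarrow> 'w \<Rightarrow> 's) \<Rightarrow> bool" where
  "markov_with M p X \<longleftrightarrow>
     (\<forall>(n::nat) (t :: nat \<Rightarrow> real) (x :: nat \<Rightarrow> 's).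
        0 \<le> t 0 \<longrightarrow> (\<forall>k\<le>n. t k \<le> t (Suc k)) \<longrightarrow>
        0 < \<P>(\<omega> in M. \<forall>k\<le>n. X (t k) \<omega> = x k) \<longrightarrow>
        \<P>(\<omega> in M. X (t (Suc n)) \<omega> = x (Suc n) \<bar> \<forall>k\<le>n. X (t k) \<omega> = x k)
          = pmf (p (t (Suc n) - t n) (x n)) (x (Suc n)))"

text \<open>Right-continuity and existence of left limits with respect to the discrete topology, in
  which convergence to \<open>y\<close> means being eventually equal to \<open>y\<close>.\<close>

definition rcll_path :: "(real \<Rightarrow> 's) \<Rightarrow> bool" where
  "rcll_path u \<longleftrightarrow>
     (\<forall>t\<ge>0. \<forall>\<^sub>F s in at_right t. u s = u t) \<and>
     (\<forall>t>0. \<exists>y. \<forall>\<^sub>F s in at_left t. u s = y)"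

text \<open>The law of \<open>X 0\<close> is not restricted. For bounded total rates, the semigroup \<open>p\<close> is
  uniquely determined by its generator.\<close>

definition markov_jump_process ::
    "'w measure \<Rightarrow> ('s::countable \<Rightarrow> 's \<Rightarrow> real) \<Rightarrow> (real \<Rightarrow> 'w \<Rightarrow> 's) \<Rightarrow> bool" where
  "markov_jump_process M r X \<longleftrightarrow>
     prob_space M \<and>
     (\<forall>t\<ge>0. X t \<in> measurable M (count_space UNIV)) \<and>
     (\<forall>\<omega>\<in>space M. rcll_path (\<lambda>t. X t \<omega>)) \<and>
     (\<exists>p. transition_semigroup p \<and> has_generator p (generator r) \<and> markov_with M p X)"

text \<open>The coordinates are indexed by a finite type \<open>'n\<close>, so that \<open>N = CARD('n)\<close>. The update
  \<open>x(i := Suc (x i))\<close> is \<open>x + e\<^sub>i\<close>, and \<open>x(i := x i - 1)\<close> is \<open>x - e\<^sub>i\<close> if \<open>x i > 0\<close>.\<close>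

definition queue_rate ::
    "('n::finite \<Rightarrow> real) \<Rightarrow> ('n \<Rightarrow> ('n \<Rightarrow> nat) \<Rightarrow> real) \<Rightarrow> ('n \<Rightarrow> nat) \<Rightarrow> ('n \<Rightarrow> nat) \<Rightarrow> real" where
  "queue_rate lam \<phi> x y =
     (\<Sum>i\<in>UNIV. (if y = x(i := Suc (x i)) then lam i else 0)
              + (if x i > 0 \<and> y = x(i := x i - 1) then \<phi> i x else 0))"

definition queue_length_process ::
    "'w measure \<Rightarrow> ('n::finite \<Rightarrow> real) \<Rightarrow> ('n \<Rightarrow> ('n \<Rightarrow> nat) \<Rightarrow> real) \<Rightarrow>
     (real \<Rightarrow> 'w \<Rightarrow> ('n \<Rightarrow> nat)) \<Rightarrow> bool" where
  "queue_length_process M lam \<phi> X \<longleftrightarrow> markov_jump_process M (queue_rate lam \<phi>) X"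

definition stable_process :: "'w measure \<Rightarrow> (real \<Rightarrow> 'w \<Rightarrow> 's::countable) \<Rightarrow> bool" where
  "stable_process M U \<longleftrightarrow>
     (\<forall>\<epsilon>>0. \<exists>K. finite K \<and> (\<forall>t\<ge>0. \<P>(\<omega> in M. U t \<omega> \<notin> K) \<le> \<epsilon>))"

definition transient_process :: "'w measure \<Rightarrow> (real \<Rightarrow> 'w \<Rightarrow> 's::countable) \<Rightarrow> bool" where
  "transient_process M U \<longleftrightarrow>
     (\<forall>K. finite K \<longrightarrow> \<P>(\<omega> in M. \<exists>s\<ge>0. \<forall>t\<ge>s. U t \<omega> \<notin> K) = 1)"

end

theory Submission
  imports Defs
begin

text \<open>The semigroup is uniformly Lipschitz in time because a state survives up to time \<open>t\<close> with
  probability at least \<open>exp (- (c + 1) * t)\<close>, so for every bounded \<open>f\<close> the expectation of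
  \<open>f (X t)\<close> has the expectation of the drift of \<open>f\<close> as its right derivative. For stability, the
  Lyapunov function is \<open>z ^ x i\<close> with \<open>z > 1\<close> close to \<open>1\<close>, whose drift is negative
  for large \<open>x i\<close>. For transience, a bounded decreasing function of \<open>x i\<close> with drift at most
  \<open>- d\<close> on a set \<open>A\<close> bounds the expected number of integer times spent in \<open>A\<close>. Since a
  visit to \<open>A\<close> during \<open>[m, m + 1)\<close> is followed, with probability bounded below, by
  \<open>X (m + 1) \<in> A\<close>, the Borel--Cantelli lemma leaves only finitely many such \<open>m\<close>.\<close>

section \<open>One-sided differential inequalities and expectations\<close>

text \<open>The generator prescribes only right derivatives at time \<open>0\<close>, and the
  Chapman-Kolmogorov equation moves these to later times as right derivatives, so all the calculus
  is one-sided. Differentiating the expectation of \<open>f (X t)\<close> is justified for bounded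
  \<open>f\<close>, whereas \<open>z ^ x i\<close> is unbounded: the function is cut off at level
  \<open>m\<close>, and the error caused by the cutoff vanishes as \<open>m\<close> tends to
  infinity at a fixed time. Coordinate \<open>i\<close> need not be Markov on its own, but the drift
  of a function of \<open>x i\<close> involves the other coordinates only through
  \<open>\<phi> i x\<close>, so bounds uniform in these coordinates suffice. The law of
  \<open>X 0\<close> is arbitrary, hence estimates are derived for each initial state and then
  averaged. For transience they are uniform in that state and average directly. For stability they
  depend on it, and the initial law is first restricted to a finite set of nearly full mass.\<close>

lemma right_increment_bound_imp_le:
  fixes u :: "real \<Rightarrow> real"
  assumes "0 \<le> T" and cont: "continuous_on {0..T} u"
    and step: "\<And>t e. 0 \<le> t \<Longrightarrow> t < T \<Longrightarrow> e > 0 \<Longrightarrow>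
      \<forall>\<^sub>F s in at_right t. u s \<le> u t + e * (s - t)"
  shows "u T \<le> u 0"
proof -
  have eps: "u T \<le> u 0 + e * T" if e: "e > 0" for e
  proof -
    \<comment> \<open>Continuous induction: this set of times is closed, and its supremum could be
      pushed further to the right if it were below \<open>T\<close>.\<close>
    define S where "S = {t \<in> {0..T}. u t - e * t \<le> u 0}"
    have "closed S"
      unfolding S_def
      by (rule continuous_on_closed_Collect_le) (auto intro!: continuous_intros cont)
    have "bdd_above S" unfolding S_def by (auto intro: bdd_aboveI[of _ T])
    have "0 \<in> S" using assms(1) by (auto simp: S_def)
    define s where "s = Sup S"
    have "s \<in> S"
      unfolding s_def using closed_contains_Sup[of S] \<open>closed S\<close> \<open>bdd_above S\<close> \<open>0 \<in> S\<close> by auto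
    have "s = T"
    proof (rule ccontr)
      assume "s \<noteq> T"
      with \<open>s \<in> S\<close> have s: "0 \<le> s" "s < T" "u s - e * s \<le> u 0" by (auto simp: S_def)
      have "\<forall>\<^sub>F r in at_right s. s < r \<and> r < T \<and> u r \<le> u s + e * (r - s)"
        using step[OF s(1,2) e] eventually_at_right_less[of s] eventually_at_right_real[OF s(2)]
        by eventually_elim auto
      from eventually_happens'[OF trivial_limit_at_right_real this]
      obtain r where r: "s < r" "r < T" "u r \<le> u s + e * (r - s)"
        by blast
      then have "r \<in> S" using s by (auto simp: S_def algebra_simps)
      then have "r \<le> s" unfolding s_def using \<open>bdd_above S\<close> by (rule cSup_upper)
      then show False using r by simp
    qed
    then show ?thesis using \<open>s \<in> S\<close> by (auto simp: S_def)
  qed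
  show ?thesis
  proof (rule field_le_epsilon)
    fix d :: real assume "d > 0"
    \<comment> \<open>Dividing by \<open>T + 1\<close> rather than by \<open>T\<close> also covers
      \<open>T = 0\<close>.\<close>
    have "u T \<le> u 0 + (d / (T + 1)) * T" using \<open>d > 0\<close> assms(1) by (intro eps) auto
    also have "(d / (T + 1)) * T \<le> d" using \<open>d > 0\<close> assms(1) by (simp add: field_simps)
    finally show "u T \<le> u 0 + d" by simp
  qed
qed

lemma right_derivative_nonpos_imp_le:
  fixes u :: "real \<Rightarrow> real"
  assumes "0 \<le> T" and cont: "continuous_on {0..T} u"
    and der: "\<And>t. 0 \<le> t \<Longrightarrow> t < T \<Longrightarrow> (u has_real_derivative D t) (at_right t)"
    and D: "\<And>t. 0 \<le> t \<Longrightarrow> t < T \<Longrightarrow> D t \<le> 0"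
  shows "u T \<le> u 0"
proof (rule right_increment_bound_imp_le[OF assms(1,2)])
  fix t e :: real assume t: "0 \<le> t" "t < T" "e > 0"
  have "((\<lambda>s. (u s - u t) / (s - t)) \<longlongrightarrow> D t) (at_right t)"
    using der[OF t(1,2)] by (simp add: has_field_derivative_iff)
  then have "\<forall>\<^sub>F s in at_right t. (u s - u t) / (s - t) < e"
    by (rule order_tendstoD) (use D[OF t(1,2)] t in auto)
  then show "\<forall>\<^sub>F s in at_right t. u s \<le> u t + e * (s - t)"
    using eventually_at_right_less[of t]
    by eventually_elim (simp add: field_simps)
qed

text \<open>The shift by \<open>a / k\<close> makes the affine bound linear, so
  \<open>exp (- k * t) * (u t + a / k)\<close> has nonpositive right derivative. Both signs of
  \<open>k\<close> occur: negative for stability, positive for a crude growth bound.\<close>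

lemma right_gronwall:
  fixes u :: "real \<Rightarrow> real"
  assumes "0 \<le> T" and "continuous_on {0..T} u" and "k \<noteq> 0"
    and "\<And>t. 0 \<le> t \<Longrightarrow> t < T \<Longrightarrow> (u has_real_derivative D t) (at_right t)"
    and "\<And>t. 0 \<le> t \<Longrightarrow> t < T \<Longrightarrow> D t \<le> a + k * u t"
  shows "u T + a / k \<le> exp (k * T) * (u 0 + a / k)"
proof -
  have "exp (- k * T) * (u T + a / k) \<le> exp (- k * 0) * (u 0 + a / k)"
  proof (rule right_derivative_nonpos_imp_le[OF assms(1)])
    show "continuous_on {0..T} (\<lambda>T. exp (- k * T) * (u T + a / k))"
      by (intro continuous_intros assms)
  next
    fix t assume t: "0 \<le> t" "t < T"
    show "((\<lambda>T. exp (- k * T) * (u T + a / k)) has_real_derivative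
        exp (- k * t) * (D t - k * (u t + a / k))) (at_right t)"
      by (rule derivative_eq_intros assms(4) t refl | simp add: algebra_simps)+
    show "exp (- k * t) * (D t - k * (u t + a / k)) \<le> 0"
    proof (rule mult_nonneg_nonpos)
      have "k * (u t + a / k) = a + k * u t" using \<open>k \<noteq> 0\<close> by (simp add: distrib_left)
      then show "D t - k * (u t + a / k) \<le> 0" using assms(5)[OF t] by linarith
    qed (rule exp_ge_zero)
  qed
  then have "exp (k * T) * (exp (- k * T) * (u T + a / k)) \<le> exp (k * T) * (u 0 + a / k)"
    by (intro mult_left_mono) auto
  then show ?thesis by (simp add: mult.assoc[symmetric] flip: exp_add)
qed

lemma pmf_integrable_bounded:
  fixes f :: "'a \<Rightarrow> real"
  assumes "\<And>x. \<bar>f x\<bar> \<le> b"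
  shows "integrable (measure_pmf q) f"
  by (rule measure_pmf.integrable_const_bound[of _ b]) (use assms in auto)

text \<open>The error comes from the mass outside \<open>F\<close>. With \<open>F\<close> a single
  state this gives the Lipschitz bound in time, and with a state and its neighbours the derivative
  at time \<open>0\<close>.\<close>

lemma pmf_expectation_finite_approx:
  fixes g :: "'a \<Rightarrow> real"
  assumes g: "\<And>y. \<bar>g y\<bar> \<le> b" and F: "finite F"
  shows "\<bar>measure_pmf.expectation q g - (\<Sum>y\<in>F. pmf q y * g y)\<bar> \<le> b * (1 - (\<Sum>y\<in>F. pmf q y))"
proof -
  have b: "0 \<le> b" using g[of undefined] by linarith
  have int: "integrable (measure_pmf q) h" if "\<And>y. \<bar>h y\<bar> \<le> b" for h :: "'a \<Rightarrow> real"
    using that by (rule pmf_integrable_bounded)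
  let ?in = "\<lambda>y. g y * indicator F y" and ?out = "\<lambda>y. g y * indicator (-F) y"
  have i1: "integrable (measure_pmf q) ?in" and i2: "integrable (measure_pmf q) ?out"
    using g b by (auto intro!: int split: split_indicator)
  have "measure_pmf.expectation q g = measure_pmf.expectation q (\<lambda>y. ?in y + ?out y)"
    by (rule Bochner_Integration.integral_cong) (auto split: split_indicator)
  also have "\<dots> = measure_pmf.expectation q ?in + measure_pmf.expectation q ?out"
    by (rule Bochner_Integration.integral_add[OF i1 i2])
  also have "measure_pmf.expectation q ?in = (\<Sum>y\<in>F. pmf q y * g y)"
    by (subst integral_measure_pmf_real[OF F]) (auto simp: F mult.commute split: split_indicator_asm)
  finally have eq: "measure_pmf.expectation q g - (\<Sum>y\<in>F. pmf q y * g y) = measure_pmf.expectation q ?out"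
    by simp
  have "\<bar>measure_pmf.expectation q ?out\<bar> \<le> measure_pmf.expectation q (\<lambda>y. \<bar>?out y\<bar>)"
    by (rule integral_abs_bound)
  also have "\<dots> \<le> measure_pmf.expectation q (\<lambda>y. b * indicator (-F) y)"
    using g b by (intro integral_mono integrable_abs i2 pmf_integrable_bounded[of _ b])
      (auto split: split_indicator)
  also have "\<dots> = b * measure_pmf.prob q (-F)" by simp
  also have "measure_pmf.prob q (-F) = 1 - (\<Sum>y\<in>F. pmf q y)"
    using measure_pmf.prob_compl[of F q] F
    by (simp add: measure_measure_pmf_finite Compl_eq_Diff_UNIV)
  finally show ?thesis using eq by simp
qed

lemma pmf_expectation_bind:
  fixes f :: "'b \<Rightarrow> real"
  assumes f: "\<And>y. \<bar>f y\<bar> \<le> b"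
  shows "measure_pmf.expectation (bind_pmf q k) f =
    measure_pmf.expectation q (\<lambda>x. measure_pmf.expectation (k x) f)"
  unfolding measure_pmf_bind
  by (rule integral_bind[where K = "count_space UNIV" and B = b and B' = 1])
    (use f measure_pmf_in_subprob_space in auto)

section \<open>Semigroups with bounded rates\<close>

text \<open>The set \<open>nb x\<close> may contain states of rate zero. Its finiteness makes the
  drift a finite sum.\<close>

locale bounded_rate_semigroup =
  fixes p :: "real \<Rightarrow> 's \<Rightarrow> 's pmf" and r :: "'s \<Rightarrow> 's \<Rightarrow> real"
    and nb :: "'s \<Rightarrow> 's set" and c :: real
  assumes semigroup: "transition_semigroup p"
    and gen: "has_generator p (generator r)"
    and finite_nb: "finite (nb x)"
    and not_in_nb: "x \<notin> nb x"
    and rate_outside: "y \<noteq> x \<Longrightarrow> y \<notin> nb x \<Longrightarrow> r x y = 0"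
    and rate_nonneg: "y \<in> nb x \<Longrightarrow> 0 \<le> r x y"
    and total_rate_le: "(\<Sum>y\<in>nb x. r x y) \<le> c"
begin

definition drift :: "('s \<Rightarrow> real) \<Rightarrow> 's \<Rightarrow> real" where
  "drift f x = (\<Sum>y\<in>nb x. r x y * (f y - f x))"

abbreviation E :: "real \<Rightarrow> 's \<Rightarrow> ('s \<Rightarrow> real) \<Rightarrow> real" where
  "E t x f \<equiv> measure_pmf.expectation (p t x) f"

lemma c_nonneg: "0 \<le> c"
  using total_rate_le sum_nonneg[of "nb _" "r _"] rate_nonneg by (meson order_trans)

lemma p_0: "p 0 x = return_pmf x"
  and p_add: "0 \<le> s \<Longrightarrow> 0 \<le> t \<Longrightarrow> p (s + t) x = bind_pmf (p s x) (p t)"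
  using semigroup by (auto simp: transition_semigroup_def)

lemma generator_self: "generator r x x = - (\<Sum>y\<in>nb x. r x y)"
proof -
  have "(\<Sum>\<^sub>\<infinity>z\<in>-{x}. r x z) = (\<Sum>\<^sub>\<infinity>z\<in>nb x. r x z)"
    by (rule infsum_cong_neutral) (use not_in_nb rate_outside in auto)
  then show ?thesis by (simp add: generator_def finite_nb)
qed

lemma generator_nb: "y \<in> nb x \<Longrightarrow> generator r x y = r x y"
  using not_in_nb by (auto simp: generator_def)

lemma pmf_deriv_0:
  "((\<lambda>t. pmf (p t x) y) has_real_derivative generator r x y) (at_right 0)"
  using gen by (auto simp: has_generator_def)

text \<open>Here \<open>pmf (p t x) x\<close> is the probability of being in \<open>x\<close> at
  time \<open>t\<close>, possibly after an excursion. Restricting the Chapman-Kolmogorov equation to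
  paths that are in \<open>x\<close> at time \<open>s\<close> gives the product.\<close>

lemma self_mult_le:
  assumes "0 \<le> s" "0 \<le> t"
  shows "pmf (p s x) x * pmf (p t x) x \<le> pmf (p (s + t) x) x"
proof -
  have "pmf (p s x) x * pmf (p t x) x = E s x (\<lambda>y. indicator {x} y * pmf (p t x) x)"
    by (simp add: measure_pmf_single)
  also have "\<dots> \<le> E s x (\<lambda>y. pmf (p t y) x)"
    by (intro integral_mono pmf_integrable_bounded[of _ 1])
      (auto simp: pmf_le_1 split: split_indicator)
  also have "\<dots> = pmf (p (s + t) x) x"
    using assms by (simp add: p_add pmf_bind)
  finally show ?thesis .
qed

lemma self_power_le:
  assumes "0 \<le> h"
  shows "pmf (p h x) x ^ n \<le> pmf (p (n * h) x) x"
proof (induction n)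
  case (Suc n)
  have "pmf (p h x) x ^ Suc n \<le> pmf (p h x) x * pmf (p (n * h) x) x"
    using Suc by (auto intro: mult_left_mono)
  also have "\<dots> \<le> pmf (p (h + n * h) x) x"
    using assms by (intro self_mult_le) auto
  finally show ?case by (simp add: algebra_simps)
qed (simp add: p_0)

text \<open>The lower bound holds for small times by the derivative at \<open>0\<close> (with a rate strictly above
  the true one, to leave room), and supermultiplicativity extends it to all times.\<close>

lemma self_ge_exp:
  assumes "0 \<le> t"
  shows "exp (- (c + 1) * t) \<le> pmf (p t x) x"
proof -
  have "((\<lambda>t. pmf (p t x) x - exp (- (c + 1) * t)) has_real_derivative generator r x x + (c + 1)) (at_right 0)"
    by (rule derivative_eq_intros pmf_deriv_0 refl | simp)+
  then have "((\<lambda>t. (pmf (p t x) x - exp (- (c + 1) * t)) / t) \<longlongrightarrow> generator r x x + (c + 1)) (at_right 0)"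
    by (simp add: has_field_derivative_iff p_0)
  then have "\<forall>\<^sub>F t in at_right 0. 0 < (pmf (p t x) x - exp (- (c + 1) * t)) / t"
    by (rule order_tendstoD) (use total_rate_le[of x] in \<open>auto simp: generator_self\<close>)
  then obtain d where d: "d > 0" "\<And>h. 0 < h \<Longrightarrow> h < d \<Longrightarrow> exp (- (c + 1) * h) \<le> pmf (p h x) x"
    by (force simp: eventually_at_right_field zero_less_divide_iff)
  obtain n :: nat where n: "t / d < n" using reals_Archimedean2 by blast
  show ?thesis
  proof (cases "t = 0")
    case False
    then have t: "0 < t" using assms by simp
    then have "0 < n" using n d(1) by (metis divide_pos_pos less_trans of_nat_0_less_iff)
    define h where "h = t / n"
    have h: "0 < h" "h < d" "t = n * h"
      using t \<open>0 < n\<close> n d(1) by (auto simp: h_def field_simps)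
    have "exp (- (c + 1) * t) = exp (- (c + 1) * h) ^ n"
      by (simp add: h(3) mult_ac flip: exp_of_nat_mult)
    also have "\<dots> \<le> pmf (p h x) x ^ n"
      using d(2) h by (intro power_mono) auto
    also have "\<dots> \<le> pmf (p t x) x"
      using self_power_le[of h x n] h by simp
    finally show ?thesis .
  qed (simp add: p_0)
qed

text \<open>The difference \<open>f y - f x\<close> vanishes at \<open>y = x\<close>, is at most
  \<open>2 * b\<close> elsewhere, and elsewhere has probability at most \<open>(c + 1) * h\<close>.
  Uniformity in \<open>x\<close> later supplies the dominating constant.\<close>

lemma expectation_increment:
  assumes f: "\<And>y. \<bar>f y\<bar> \<le> b" and "0 \<le> h"
  shows "\<bar>E h x f - f x\<bar> \<le> 2 * b * (c + 1) * h"
proof -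
  have b: "0 \<le> b" using f[of undefined] by linarith
  have "\<bar>f y - f x\<bar> \<le> 2 * b" for y using f[of y] f[of x] by linarith
  then have "\<bar>E h x (\<lambda>y. f y - f x)\<bar> \<le> 2 * b * (1 - pmf (p h x) x)"
    using pmf_expectation_finite_approx[of "\<lambda>y. f y - f x" "2 * b" "{x}" "p h x"] by simp
  also have "\<dots> \<le> 2 * b * ((c + 1) * h)"
    using self_ge_exp[OF assms(2), of x] exp_ge_add_one_self[of "- (c + 1) * h"] b
    by (intro mult_left_mono) (auto simp: algebra_simps)
  also have "E h x (\<lambda>y. f y - f x) = E h x f - f x"
    using pmf_integrable_bounded[of f b] f by simp
  finally show ?thesis by simp
qed

text \<open>The generator controls single transition probabilities only. The derivatives over
  \<open>insert x (nb x)\<close> sum to zero and the total mass is one, so the mass outside this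
  finite set is of smaller order than \<open>h\<close>.\<close>

lemma expectation_deriv_0:
  assumes f: "\<And>y. \<bar>f y\<bar> \<le> b"
  shows "((\<lambda>h. (E h x f - f x) / h) \<longlongrightarrow> drift f x) (at_right 0)"
proof -
  let ?F = "insert x (nb x)"
  define rest where "rest h = 2 * b * ((1 - (\<Sum>y\<in>?F. pmf (p h x) y)) / h)" for h
  define main where "main h = (\<Sum>y\<in>nb x. pmf (p h x) y / h * (f y - f x))" for h
  have pm: "((\<lambda>h. pmf (p h x) y / h) \<longlongrightarrow> r x y) (at_right 0)" if "y \<in> nb x" for y
  proof -
    have "x \<noteq> y" using that not_in_nb by auto
    then show ?thesis
      using pmf_deriv_0[of x y] generator_nb[OF that] by (simp add: has_field_derivative_iff p_0)
  qed
  have px: "((\<lambda>h. (pmf (p h x) x - 1) / h) \<longlongrightarrow> - (\<Sum>y\<in>nb x. r x y)) (at_right 0)"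
    using pmf_deriv_0[of x x]
    by (auto simp: has_field_derivative_iff p_0 generator_self)
  have main: "(main \<longlongrightarrow> drift f x) (at_right 0)"
    unfolding main_def drift_def by (intro tendsto_intros pm)
  have "((\<lambda>h. 2 * b * - ((pmf (p h x) x - 1) / h + (\<Sum>y\<in>nb x. pmf (p h x) y / h))) \<longlongrightarrow>
      2 * b * - (- (\<Sum>y\<in>nb x. r x y) + (\<Sum>y\<in>nb x. r x y))) (at_right 0)"
    by (intro tendsto_intros pm px)
  then have rest: "(rest \<longlongrightarrow> 0) (at_right 0)"
    unfolding rest_def using not_in_nb[of x] finite_nb[of x]
    by (simp add: diff_divide_distrib add_divide_distrib sum_divide_distrib algebra_simps)
  have bound: "\<bar>(E h x f - f x) / h - main h\<bar> \<le> rest h" if h: "0 < h" for h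
  proof -
    have "\<bar>f y - f x\<bar> \<le> 2 * b" for y using f[of y] f[of x] by linarith
    then have "\<bar>E h x (\<lambda>y. f y - f x) - (\<Sum>y\<in>?F. pmf (p h x) y * (f y - f x))\<bar>
        \<le> 2 * b * (1 - (\<Sum>y\<in>?F. pmf (p h x) y))"
      by (rule pmf_expectation_finite_approx) (simp add: finite_nb)
    moreover have "E h x (\<lambda>y. f y - f x) = E h x f - f x"
      using pmf_integrable_bounded[of f b] f by simp
    moreover have "(\<Sum>y\<in>?F. pmf (p h x) y * (f y - f x)) = h * main h"
      using not_in_nb[of x] finite_nb[of x] h by (simp add: main_def sum_distrib_left)
    ultimately have "\<bar>E h x f - f x - h * main h\<bar> \<le> h * rest h"
      using h by (simp add: rest_def mult_ac)
    then have "\<bar>E h x f - f x - h * main h\<bar> / h \<le> rest h"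
      using h by (simp add: field_simps)
    moreover have "(E h x f - f x) / h - main h = (E h x f - f x - h * main h) / h"
      using h by (simp add: field_simps)
    ultimately show ?thesis using h by (simp add: abs_divide)
  qed
  have "((\<lambda>h. (E h x f - f x) / h - main h) \<longlongrightarrow> 0) (at_right 0)"
    by (rule Lim_null_comparison[OF _ rest])
      (use bound in \<open>auto simp: eventually_at_right_field intro: exI[of _ 1]\<close>)
  from tendsto_add[OF this main] show ?thesis by simp
qed

section \<open>The forward equation for bounded functions\<close>

lemma E_add:
  assumes "\<And>y. \<bar>f y\<bar> \<le> b" "0 \<le> s" "0 \<le> t"
  shows "E (s + t) x f = E s x (\<lambda>y. E t y f)"
  using assms by (simp add: p_add pmf_expectation_bind[of f b])

lemma abs_E_le:
  assumes "\<And>y. \<bar>f y\<bar> \<le> b"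
  shows "\<bar>E t x f\<bar> \<le> b"
proof -
  have "\<bar>E t x f\<bar> \<le> E t x (\<lambda>y. \<bar>f y\<bar>)" by (rule integral_abs_bound)
  also have "\<dots> \<le> E t x (\<lambda>_. b)"
    using assms by (intro integral_mono pmf_integrable_bounded[of _ b]) (auto intro: order_trans[OF abs_ge_zero])
  finally show ?thesis by simp
qed

lemma E_increment:
  assumes f: "\<And>y. \<bar>f y\<bar> \<le> b" and "0 \<le> s" "s \<le> t"
  shows "E t x f - E s x f = E s x (\<lambda>y. E (t - s) y f - f y)"
proof -
  have "E t x f = E s x (\<lambda>y. E (t - s) y f)"
    using E_add[OF f, of s "t - s"] assms by simp
  then show ?thesis
    using pmf_integrable_bounded[of f b] pmf_integrable_bounded[of "\<lambda>y. E (t - s) y f" b]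
      f abs_E_le[of f b] by simp
qed

lemma E_lipschitz:
  assumes f: "\<And>y. \<bar>f y\<bar> \<le> b" and "0 \<le> s" "s \<le> t"
  shows "\<bar>E t x f - E s x f\<bar> \<le> 2 * b * (c + 1) * (t - s)"
  unfolding E_increment[OF assms]
  by (rule abs_E_le, rule expectation_increment) (use assms in auto)

lemma E_continuous:
  assumes f: "\<And>y. \<bar>f y\<bar> \<le> b"
  shows "continuous_on {0..T} (\<lambda>t. E t x f)"
proof (rule lipschitz_on_continuous_on)
  have b: "0 \<le> b" using f[of undefined] by linarith
  show "(2 * b * (c + 1))-lipschitz_on {0..T} (\<lambda>t. E t x f)"
  proof (rule lipschitz_onI)
    fix s t assume "s \<in> {0..T}" "t \<in> {0..T}"
    then show "dist (E s x f) (E t x f) \<le> 2 * b * (c + 1) * dist s t"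
      using E_lipschitz[OF f, of s t x] E_lipschitz[OF f, of t s x]
      by (cases "s \<le> t") (auto simp: dist_real_def abs_minus_commute)
  qed (use b c_nonneg in auto)
qed

text \<open>Kolmogorov's forward equation tested against bounded functions. The difference quotients are
  bounded uniformly in the state, so dominated convergence applies.\<close>

lemma E_right_derivative:
  assumes f: "\<And>y. \<bar>f y\<bar> \<le> b" and t: "0 \<le> t"
  shows "((\<lambda>t. E t x f) has_real_derivative E t x (drift f)) (at_right t)"
  unfolding has_field_derivative_iff
proof (rule tendsto_at_right_sequentially[of t "t + 1"])
  fix S assume S: "\<And>n. t < S n" "S \<longlonglongrightarrow> t"
  let ?g = "\<lambda>n y. (E (S n - t) y f - f y) / (S n - t)"
  have "(\<lambda>n. S n - t) \<longlonglongrightarrow> 0" using S(2) by (simp add: LIM_zero_iff)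
  then have "filterlim (\<lambda>n. S n - t) (at_right 0) sequentially"
    using S(1) by (auto simp: filterlim_at intro!: always_eventually)
  then have lim: "(\<lambda>n. ?g n y) \<longlonglongrightarrow> drift f y" for y
    by (rule filterlim_compose[OF expectation_deriv_0[OF f]])
  have "(\<lambda>n. E t x (?g n)) \<longlonglongrightarrow> E t x (drift f)"
  proof (rule integral_dominated_convergence[where w = "\<lambda>_. 2 * b * (c + 1)"])
    fix n
    show "AE y in p t x. norm (?g n y) \<le> 2 * b * (c + 1)"
      using expectation_increment[of f b, OF f, of "S n - t"] S(1)[of n]
      by (auto simp: divide_simps)
  qed (use lim in auto)
  moreover have "(E (S n) x f - E t x f) / (S n - t) = E t x (?g n)" for n
    using E_increment[OF f t, of "S n" x] S(1)[of n] by simp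
  ultimately show "(\<lambda>n. (E (S n) x f - E t x f) / (S n - t)) \<longlonglongrightarrow> E t x (drift f)"
    by (simp only:)
qed simp

section \<open>Consequences of drift inequalities\<close>

lemma drift_bounded:
  assumes f: "\<And>y. \<bar>f y\<bar> \<le> b"
  shows "\<bar>drift f x\<bar> \<le> 2 * b * c"
proof -
  have b: "0 \<le> b" using f[of undefined] by linarith
  have "\<bar>drift f x\<bar> \<le> (\<Sum>y\<in>nb x. \<bar>r x y * (f y - f x)\<bar>)"
    unfolding drift_def by (rule sum_abs)
  also have "\<dots> \<le> (\<Sum>y\<in>nb x. r x y * (2 * b))"
  proof (rule sum_mono)
    fix y assume "y \<in> nb x"
    moreover have "\<bar>f y - f x\<bar> \<le> 2 * b" using f[of y] f[of x] by linarith
    ultimately show "\<bar>r x y * (f y - f x)\<bar> \<le> r x y * (2 * b)"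
      using rate_nonneg by (auto simp: abs_mult intro: mult_left_mono)
  qed
  also have "\<dots> = 2 * b * (\<Sum>y\<in>nb x. r x y)" by (simp add: sum_distrib_left mult_ac)
  also have "\<dots> \<le> 2 * b * c" using b total_rate_le by (intro mult_left_mono) auto
  finally show ?thesis .
qed

text \<open>The term \<open>g\<close> is an error that may be large at some states; only its
  expectation enters the constant, and \<open>b'\<close> serves integrability.\<close>

lemma drift_gronwall:
  assumes f: "\<And>y. \<bar>f y\<bar> \<le> b" and g: "\<And>y. \<bar>g y\<bar> \<le> b'"
    and "0 \<le> T" "k \<noteq> 0"
    and drift: "\<And>y. drift f y \<le> a + k * f y + g y"
    and Eg: "\<And>t. 0 \<le> t \<Longrightarrow> t < T \<Longrightarrow> E t x g \<le> d"
  shows "E T x f + (a + d) / k \<le> exp (k * T) * (f x + (a + d) / k)"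
proof -
  have "E t x (drift f) \<le> (a + d) + k * E t x f" if "0 \<le> t" "t < T" for t
  proof -
    have i: "integrable (p t x) f" "integrable (p t x) g" "integrable (p t x) (drift f)"
      using pmf_integrable_bounded[of f b, OF f] pmf_integrable_bounded[of g b', OF g]
        pmf_integrable_bounded[of "drift f", OF drift_bounded[of f b, OF f]] by auto
    have "E t x (drift f) \<le> E t x (\<lambda>y. a + k * f y + g y)"
      by (intro integral_mono drift i Bochner_Integration.integrable_add integrable_mult_right) auto
    also have "\<dots> = a + k * E t x f + E t x g"
      using i by simp
    finally show ?thesis using Eg[OF that] by simp
  qed
  then show ?thesis
    using right_gronwall[of T "\<lambda>t. E t x f" k "\<lambda>t. E t x (drift f)" "a + d"]
      E_continuous[OF f] E_right_derivative[OF f] assms(3,4)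
    by (simp add: p_0)
qed

text \<open>From \<open>y\<close> in \<open>A\<close>, the state at each time in
  \<open>[0, 1]\<close> is again \<open>y\<close> with probability at least
  \<open>exp (- (c + 1))\<close>. Hence one unit of time lowers the expectation of \<open>f\<close>
  by at least \<open>d * exp (- (c + 1))\<close> times the probability of \<open>A\<close>; these
  losses telescope and cannot exceed \<open>b\<close>.\<close>

lemma occupation_sum_le:
  assumes f: "\<And>y. 0 \<le> f y" "\<And>y. f y \<le> b" and "0 \<le> d"
    and drift: "\<And>y. drift f y \<le> - d * indicator A y"
  shows "d * exp (- (c + 1)) * (\<Sum>m<n. measure_pmf.prob (p (real m) x) A) \<le> b"
proof -
  have abs_f: "\<bar>f y\<bar> \<le> b" for y using f[of y] by simp
  let ?a = "d * exp (- (c + 1))"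
  have unit_step: "E 1 y f + ?a * indicator A y \<le> f y" for y
  proof -
    have "E 1 y f + ?a * indicator A y * 1 \<le> E 0 y f + ?a * indicator A y * 0"
    proof (rule right_derivative_nonpos_imp_le)
      show "continuous_on {0..1} (\<lambda>t. E t y f + ?a * indicator A y * t)"
        by (intro continuous_intros E_continuous[OF abs_f])
    next
      fix t :: real assume t: "0 \<le> t" "t < 1"
      show "((\<lambda>t. E t y f + ?a * indicator A y * t) has_real_derivative
          E t y (drift f) + ?a * indicator A y) (at_right t)"
        by (rule derivative_eq_intros E_right_derivative[OF abs_f] t refl | simp)+
      have "E t y (drift f) \<le> E t y (\<lambda>z. - d * indicator A z)"
        using \<open>0 \<le> d\<close> by (intro integral_mono drift pmf_integrable_bounded[OF drift_bounded[OF abs_f]]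
            pmf_integrable_bounded[of _ d]) (auto split: split_indicator)
      also have "\<dots> = - d * measure_pmf.prob (p t y) A" by simp
      also have "\<dots> \<le> - ?a * indicator A y"
      proof (cases "y \<in> A")
        case True
        have "exp (- (c + 1)) \<le> exp (- (c + 1) * t)"
          using t c_nonneg mult_left_le[of t "c + 1"] by simp
        also have "\<dots> \<le> pmf (p t y) y" using t by (intro self_ge_exp)
        also have "\<dots> \<le> measure_pmf.prob (p t y) A"
          using True by (auto simp: pmf.rep_eq intro: measure_pmf.finite_measure_mono)
        finally show ?thesis using True \<open>0 \<le> d\<close> by (simp add: mult_left_mono)
      qed (use \<open>0 \<le> d\<close> in simp)
      finally show "E t y (drift f) + ?a * indicator A y \<le> 0" by simp
    qed simp
    then show ?thesis by (simp add: p_0)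
  qed
  have "?a * (\<Sum>m<n. measure_pmf.prob (p (real m) x) A) \<le> f x - E (real n) x f"
  proof (induction n)
    case (Suc n)
    have int: "integrable (p s x) f" "integrable (p s x) (\<lambda>y. E 1 y f)" for s
      using pmf_integrable_bounded[of f b] pmf_integrable_bounded[of "\<lambda>y. E 1 y f" b]
        abs_f abs_E_le[of f b] by auto
    have int_A: "integrable (p s x) (\<lambda>y. ?a * indicator A y)" for s
      by (rule pmf_integrable_bounded[of _ "\<bar>?a\<bar>"]) (auto split: split_indicator)
    have "E (real (Suc n)) x f = E n x (\<lambda>y. E 1 y f)"
      using E_add[of f b "real n" 1 x] abs_f by (simp add: add.commute)
    also have "\<dots> \<le> E n x (\<lambda>y. f y - ?a * indicator A y)"
      using unit_step by (intro integral_mono int int_A Bochner_Integration.integrable_diff)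
        (auto simp: algebra_simps)
    also have "\<dots> = E n x f - ?a * measure_pmf.prob (p n x) A"
      by (subst Bochner_Integration.integral_diff[OF int(1) int_A]) simp
    finally show ?case using Suc by (simp add: algebra_simps)
  qed (simp add: p_0)
  moreover have "0 \<le> E (real n) x f" using f by simp
  ultimately show ?thesis using f(2)[of x] by linarith
qed

end

section \<open>Processes with bounded rates\<close>

text \<open>Countable additivity along \<open>nat\<close>, transported by \<open>to_nat\<close>;
  numbers outside its range contribute empty events.\<close>

lemma (in prob_space) has_sum_prob_partition:
  fixes Y :: "'a \<Rightarrow> 'b::countable"
  assumes [measurable]: "Y \<in> measurable M (count_space UNIV)" "A \<in> events"
  shows "((\<lambda>y. prob (A \<inter> {\<omega> \<in> space M. Y \<omega> = y})) has_sum prob A) UNIV"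
proof -
  let ?B = "\<lambda>n::nat. A \<inter> {\<omega> \<in> space M. to_nat (Y \<omega>) = n}"
  have "(\<lambda>n. prob (?B n)) sums prob (\<Union>n. ?B n)"
    by (rule finite_measure_UNION) (auto simp: disjoint_family_on_def)
  also have "(\<Union>n. ?B n) = A" using sets.sets_into_space[OF assms(2)] by auto
  finally have "((\<lambda>n. prob (?B n)) has_sum prob A) UNIV"
    by (rule sums_nonneg_imp_has_sum) simp
  also have "?this \<longleftrightarrow> ((\<lambda>n. prob (?B n)) has_sum prob A) (range (to_nat :: 'b \<Rightarrow> nat))"
    by (rule has_sum_cong_neutral) (auto intro!: arg_cong[where f = prob, of _ "{}", simplified])
  finally show ?thesis
    by (subst (asm) has_sum_reindex) (auto simp: comp_def)
qed

locale rcll_markov_process = prob_space M + bounded_rate_semigroup p r nb c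
  for M :: "'w measure" and p :: "real \<Rightarrow> 's::countable \<Rightarrow> 's pmf" and r nb c +
  fixes X :: "real \<Rightarrow> 'w \<Rightarrow> 's"
  assumes X_measurable: "0 \<le> t \<Longrightarrow> X t \<in> measurable M (count_space UNIV)"
    and rcll: "\<omega> \<in> space M \<Longrightarrow> rcll_path (\<lambda>t. X t \<omega>)"
    and markov: "markov_with M p X"
begin

lemma X_in_sets [measurable]: "0 \<le> t \<Longrightarrow> {\<omega> \<in> space M. X t \<omega> \<in> B} \<in> events"
  using measurable_sets[OF X_measurable, of t B] by (simp add: vimage_def Int_def conj_commute)

lemma history_in_sets:
  fixes n :: nat
  assumes "\<And>k. k \<le> n \<Longrightarrow> 0 \<le> t k"
  shows "{\<omega> \<in> space M. \<forall>k\<le>n. X (t k) \<omega> = x k} \<in> events"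
proof -
  have "{\<omega> \<in> space M. \<forall>k\<in>{..n}. X (t k) \<omega> \<in> {x k}} \<in> events"
    by (intro sets.sets_Collect_finite_All X_in_sets) (use assms in auto)
  then show ?thesis by (simp only: Ball_def atMost_iff singleton_iff)
qed

text \<open>The Markov property in product form, valid also for null histories: these are excluded
  in \<open>markov_with\<close>, but both sides vanish for them.\<close>

lemma prob_history_step:
  assumes t: "0 \<le> t 0" "\<And>k. k < n \<Longrightarrow> t k \<le> t (Suc k)" and "t n \<le> T"
  shows "prob {\<omega> \<in> space M. (\<forall>k\<le>n. X (t k) \<omega> = x k) \<and> X T \<omega> = y} =
    prob {\<omega> \<in> space M. \<forall>k\<le>n. X (t k) \<omega> = x k} * pmf (p (T - t n) (x n)) y"
proof -
  let ?t = "t(Suc n := T)" and ?x = "x(Suc n := y)"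
  let ?H = "{\<omega> \<in> space M. \<forall>k\<le>n. X (t k) \<omega> = x k}"
  have nonneg: "0 \<le> t k" if "k \<le> n" for k
    using that by (induction k) (use t in \<open>auto intro: order_trans\<close>)
  have eq: "{\<omega> \<in> space M. \<forall>k\<le>n. X (?t k) \<omega> = ?x k} = ?H" by auto
  show ?thesis
  proof (cases "prob ?H = 0")
    case True
    have "prob {\<omega> \<in> space M. (\<forall>k\<le>n. X (t k) \<omega> = x k) \<and> X T \<omega> = y} \<le> prob ?H"
      by (intro finite_measure_mono history_in_sets nonneg) auto
    then have "prob {\<omega> \<in> space M. (\<forall>k\<le>n. X (t k) \<omega> = x k) \<and> X T \<omega> = y} = 0"
      unfolding True by (intro antisym measure_nonneg)
    then show ?thesis using True by simp
  next
    case False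
    then have "0 < prob ?H" using measure_nonneg[of M ?H] by linarith
    moreover have "\<forall>k\<le>n. ?t k \<le> ?t (Suc k)" "0 \<le> ?t 0"
      using t \<open>t n \<le> T\<close> nonneg by (auto simp: le_less)
    ultimately have "\<P>(\<omega> in M. X (?t (Suc n)) \<omega> = ?x (Suc n) \<bar> \<forall>k\<le>n. X (?t k) \<omega> = ?x k) =
        pmf (p (?t (Suc n) - ?t n) (?x n)) (?x (Suc n))"
      using markov[unfolded markov_with_def, THEN spec[of _ n], THEN spec[of _ ?t], THEN spec[of _ ?x]]
      unfolding eq by blast
    then show ?thesis
      using False unfolding cond_prob_def eq by (simp add: field_simps conj_commute)
  qed
qed

lemma prob_initial_transition:
  assumes "0 \<le> t"
  shows "prob {\<omega> \<in> space M. X 0 \<omega> = x \<and> X t \<omega> \<in> B} =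
    prob {\<omega> \<in> space M. X 0 \<omega> = x} * measure_pmf.prob (p t x) B"
proof -
  let ?A = "{\<omega> \<in> space M. X 0 \<omega> = x \<and> X t \<omega> \<in> B}"
  have [measurable]: "?A \<in> events"
    using X_in_sets[of 0 "{x}"] X_in_sets[OF assms, of B] by simp
  have "((\<lambda>y. prob (?A \<inter> {\<omega> \<in> space M. X t \<omega> = y})) has_sum prob ?A) UNIV"
    using X_measurable[OF assms] by (intro has_sum_prob_partition) auto
  moreover have "prob (?A \<inter> {\<omega> \<in> space M. X t \<omega> = y}) =
      prob {\<omega> \<in> space M. X 0 \<omega> = x} * measure_pmf.prob (p t x) (B \<inter> {\<omega> \<in> space (p t x). \<omega> = y})" for y
  proof (cases "y \<in> B")
    case True
    then have "?A \<inter> {\<omega> \<in> space M. X t \<omega> = y} = {\<omega> \<in> space M. (\<forall>k\<le>0::nat. X ((\<lambda>_. 0) k) \<omega> = x) \<and> X t \<omega> = y}"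
      and "B \<inter> {\<omega> \<in> space (p t x). \<omega> = y} = {y}"
      by auto
    then show ?thesis
      using prob_history_step[of "\<lambda>_. 0" 0 t "\<lambda>_. x" y] assms by (simp add: measure_pmf_single)
  next
    case False
    then have "?A \<inter> {\<omega> \<in> space M. X t \<omega> = y} = {}" "B \<inter> {\<omega> \<in> space (p t x). \<omega> = y} = {}" by auto
    then show ?thesis by (simp only: measure_empty mult_zero_right)
  qed
  moreover have "((\<lambda>y. measure_pmf.prob (p t x) (B \<inter> {\<omega> \<in> space (p t x). \<omega> = y})) has_sum
      measure_pmf.prob (p t x) B) UNIV"
    by (intro measure_pmf.has_sum_prob_partition) auto
  then have "((\<lambda>y. prob {\<omega> \<in> space M. X 0 \<omega> = x} *
      measure_pmf.prob (p t x) (B \<inter> {\<omega> \<in> space (p t x). \<omega> = y})) has_sum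
      prob {\<omega> \<in> space M. X 0 \<omega> = x} * measure_pmf.prob (p t x) B) UNIV"
    by (rule has_sum_cmult_right)
  ultimately show ?thesis by (metis (no_types, lifting) has_sum_cong has_sum_unique)
qed

text \<open>The law of \<open>X t\<close> is the mixture of the \<open>p t x\<close> over the law of
  \<open>X 0\<close>. This carries estimates for a fixed initial state to an arbitrary initial
  law.\<close>

lemma has_sum_prob_initial:
  assumes "0 \<le> t"
  shows "((\<lambda>x. prob {\<omega> \<in> space M. X 0 \<omega> = x} * measure_pmf.prob (p t x) B) has_sum
    prob {\<omega> \<in> space M. X t \<omega> \<in> B}) UNIV"
proof -
  have "((\<lambda>x. prob ({\<omega> \<in> space M. X t \<omega> \<in> B} \<inter> {\<omega> \<in> space M. X 0 \<omega> = x})) has_sum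
      prob {\<omega> \<in> space M. X t \<omega> \<in> B}) UNIV"
    using X_measurable[of 0] X_in_sets[OF assms] by (intro has_sum_prob_partition) auto
  moreover have "{\<omega> \<in> space M. X t \<omega> \<in> B} \<inter> {\<omega> \<in> space M. X 0 \<omega> = x} =
      {\<omega> \<in> space M. X 0 \<omega> = x \<and> X t \<omega> \<in> B}" for x by auto
  ultimately show ?thesis by (simp add: prob_initial_transition[OF assms])
qed

lemma has_sum_prob_initial_1: "((\<lambda>x. prob {\<omega> \<in> space M. X 0 \<omega> = x}) has_sum 1) UNIV"
  using has_sum_prob_initial[of 0 UNIV] by (simp add: prob_space)

text \<open>Once the process is in \<open>A\<close>, it stays where it is up to time \<open>T\<close> with at least the
  probability of \<open>self_ge_exp\<close>. The sum runs over the histories up to the first visit.\<close>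

lemma prob_grid_visit_le:
  assumes t: "0 \<le> t 0" "\<And>k. k < n \<Longrightarrow> t k \<le> t (Suc k)" and T: "t n \<le> T"
  shows "exp (- (c + 1) * (T - t 0)) * prob {\<omega> \<in> space M. \<exists>k\<le>n. X (t k) \<omega> \<in> A} \<le>
    prob {\<omega> \<in> space M. X T \<omega> \<in> A}"
proof -
  have mono: "t j \<le> t k" if "j \<le> k" "k \<le> n" for j k
    using that by (induction k) (use t in \<open>auto simp: le_Suc_eq intro: order_trans\<close>)
  have nonneg: "0 \<le> t k" if "k \<le> n" for k using mono[of 0 k] that t(1) by simp
  have T0: "0 \<le> T" using nonneg[of n] T by simp
  let ?e = "exp (- (c + 1) * (T - t 0))"
  \<comment> \<open>The first visit to \<open>A\<close> along the grid occurs at index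
    \<open>j\<close>; these events are disjoint.\<close>
  define F where "F j = {\<omega> \<in> space M. (\<forall>k<j. X (t k) \<omega> \<notin> A) \<and> X (t j) \<omega> \<in> A}" for j
  let ?XT = "{\<omega> \<in> space M. X T \<omega> \<in> A}"
  have F_sets: "F j \<in> events" if "j \<le> n" for j
  proof -
    have "{\<omega> \<in> space M. \<forall>k\<in>{..<j}. X (t k) \<omega> \<in> -A} \<in> events"
      by (intro sets.sets_Collect_finite_All X_in_sets) (use that nonneg in auto)
    moreover have "{\<omega> \<in> space M. X (t j) \<omega> \<in> A} \<in> events" using nonneg that by auto
    ultimately have "{\<omega> \<in> space M. \<forall>k\<in>{..<j}. X (t k) \<omega> \<in> -A} \<inter> {\<omega> \<in> space M. X (t j) \<omega> \<in> A} \<in> events"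
      by (rule sets.Int)
    also have "{\<omega> \<in> space M. \<forall>k\<in>{..<j}. X (t k) \<omega> \<in> -A} \<inter> {\<omega> \<in> space M. X (t j) \<omega> \<in> A} = F j"
      by (auto simp: F_def)
    finally show ?thesis .
  qed
  have XT_sets: "?XT \<in> events" using T0 by auto
  have disj: "disjoint_family_on F {..n}"
    unfolding disjoint_family_on_def F_def by (auto, metis linorder_neqE_nat)
  have step: "?e * prob (F j) \<le> prob (F j \<inter> ?XT)" if j: "j \<le> n" for j
  proof -
    \<comment> \<open>The Markov property is stated for exact states, so \<open>F j\<close> is split
      according to the list of states seen up to index \<open>j\<close>. There are countably many
      such lists.\<close>
    define Y where "Y \<omega> = map (\<lambda>k. X (t k) \<omega>) [0..<Suc j]" for \<omega>
    have Y_iff: "Y \<omega> = l \<longleftrightarrow> length l = Suc j \<and> (\<forall>k\<le>j. X (t k) \<omega> = l ! k)" for \<omega> l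
      unfolding Y_def by (auto simp: list_eq_iff_nth_eq less_Suc_eq_le simp del: upt_Suc)
    have "{\<omega> \<in> space M. Y \<omega> = l} \<in> events" for l
    proof (cases "length l = Suc j")
      case True
      have "{\<omega> \<in> space M. \<forall>k\<le>j. X (t k) \<omega> = l ! k} \<in> events"
        by (intro history_in_sets nonneg) (use j in linarith)
      then show ?thesis using True by (simp only: Y_iff simp_thms)
    qed (simp add: Y_iff)
    then have Y: "Y \<in> measurable M (count_space UNIV)"
      by (subst measurable_count_space_eq_countable)
        (auto simp: vimage_def Int_def conj_commute)
    have le: "?e * prob (F j \<inter> {\<omega> \<in> space M. Y \<omega> = l}) \<le>
        prob ((F j \<inter> ?XT) \<inter> {\<omega> \<in> space M. Y \<omega> = l})" for l
    proof (cases "length l = Suc j \<and> (\<forall>k<j. l ! k \<notin> A) \<and> l ! j \<in> A")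
      case True
      let ?H = "{\<omega> \<in> space M. \<forall>k\<le>j. X (t k) \<omega> = l ! k}"
      have H: "F j \<inter> {\<omega> \<in> space M. Y \<omega> = l} = ?H"
        using True unfolding Y_iff F_def by auto
      have "?e \<le> exp (- (c + 1) * (T - t j))"
        using mono[of 0 j] j c_nonneg by (simp add: mult_left_mono)
      also have "\<dots> \<le> pmf (p (T - t j) (l ! j)) (l ! j)"
        using mono[of j n] j T by (intro self_ge_exp) simp
      finally have "?e * prob ?H \<le> prob ?H * pmf (p (T - t j) (l ! j)) (l ! j)"
        by (simp add: mult.commute mult_right_mono)
      also have "\<dots> = prob {\<omega> \<in> space M. (\<forall>k\<le>j. X (t k) \<omega> = l ! k) \<and> X T \<omega> = l ! j}"
        using t j mono[of j n] T by (intro prob_history_step[symmetric]) auto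
      also have "\<dots> \<le> prob ((F j \<inter> ?XT) \<inter> {\<omega> \<in> space M. Y \<omega> = l})"
      proof (rule finite_measure_mono)
        show "(F j \<inter> ?XT) \<inter> {\<omega> \<in> space M. Y \<omega> = l} \<in> events"
          using F_sets[OF j] XT_sets \<open>\<And>l. {\<omega> \<in> space M. Y \<omega> = l} \<in> events\<close> by (intro sets.Int) auto
      qed (use True in \<open>auto simp: Y_iff F_def\<close>)
      finally show ?thesis unfolding H .
    next
      case False
      then have "F j \<inter> {\<omega> \<in> space M. Y \<omega> = l} = {}" unfolding Y_iff F_def by auto
      then show ?thesis by (simp only: measure_empty mult_zero_right measure_nonneg)
    qed
    have "((\<lambda>l. ?e * prob (F j \<inter> {\<omega> \<in> space M. Y \<omega> = l})) has_sum ?e * prob (F j)) UNIV"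
      using F_sets[OF j] Y by (intro has_sum_cmult_right has_sum_prob_partition)
    moreover have "((\<lambda>l. prob ((F j \<inter> ?XT) \<inter> {\<omega> \<in> space M. Y \<omega> = l})) has_sum prob (F j \<inter> ?XT)) UNIV"
      using F_sets[OF j] XT_sets Y by (intro has_sum_prob_partition) auto
    ultimately show ?thesis using le by (rule has_sum_mono)
  qed
  have "{\<omega> \<in> space M. \<exists>k\<le>n. X (t k) \<omega> \<in> A} = (\<Union>j\<in>{..n}. F j)"
  proof (intro set_eqI iffI)
    fix \<omega> assume *: "\<omega> \<in> {\<omega> \<in> space M. \<exists>k\<le>n. X (t k) \<omega> \<in> A}"
    then obtain k where k: "k \<le> n" "X (t k) \<omega> \<in> A" by auto
    let ?j = "LEAST k. X (t k) \<omega> \<in> A"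
    have "X (t ?j) \<omega> \<in> A" "?j \<le> k" using k(2) by (auto intro: LeastI Least_le)
    then have "\<omega> \<in> F ?j" "?j \<le> n" using * k(1) not_less_Least by (auto simp: F_def)
    then show "\<omega> \<in> (\<Union>j\<in>{..n}. F j)" by auto
  qed (auto simp: F_def)
  then have "prob {\<omega> \<in> space M. \<exists>k\<le>n. X (t k) \<omega> \<in> A} = (\<Sum>j\<le>n. prob (F j))"
    using F_sets disj by (simp add: finite_measure_finite_Union image_subset_iff)
  then have "?e * prob {\<omega> \<in> space M. \<exists>k\<le>n. X (t k) \<omega> \<in> A} = (\<Sum>j\<le>n. ?e * prob (F j))"
    by (simp add: sum_distrib_left)
  also have "\<dots> \<le> (\<Sum>j\<le>n. prob (F j \<inter> ?XT))" using step by (intro sum_mono) auto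
  also have "\<dots> = prob (\<Union>j\<in>{..n}. F j \<inter> ?XT)"
    using F_sets XT_sets disj
    by (intro finite_measure_finite_Union[symmetric]) (auto simp: disjoint_family_on_def)
  also have "\<dots> \<le> prob ?XT" using XT_sets by (intro finite_measure_mono) auto
  finally show ?thesis .
qed

end

lemma has_sum_finite_sum:
  fixes f :: "'i \<Rightarrow> 'a \<Rightarrow> real"
  assumes "finite I" "\<And>i. i \<in> I \<Longrightarrow> (f i has_sum s i) A"
  shows "((\<lambda>x. \<Sum>i\<in>I. f i x) has_sum (\<Sum>i\<in>I. s i)) A"
  using assms by (induction I rule: finite_induct) (auto intro: has_sum_add)

section \<open>From integer times to all times\<close>

context rcll_markov_process
begin

abbreviation grid_visit :: "nat \<Rightarrow> nat \<Rightarrow> 's set \<Rightarrow> 'w set" where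
  "grid_visit m l A \<equiv> {\<omega> \<in> space M. \<exists>k<2 ^ l. X (real m + real k / 2 ^ l) \<omega> \<in> A}"

lemma grid_visit_in_sets: "grid_visit m l A \<in> events"
proof -
  have "{\<omega> \<in> space M. \<exists>k\<in>{..<2 ^ l :: nat}. X (real m + real k / 2 ^ l) \<omega> \<in> A} \<in> events"
    by (intro sets.sets_Collect_finite_Ex X_in_sets) auto
  then show ?thesis by (simp only: Bex_def lessThan_iff)
qed

text \<open>A right-continuous path in a discrete space is constant on a short interval to the right
  of \<open>t\<close>, and a fine enough dyadic grid meets that interval.\<close>

lemma visit_imp_grid_visit:
  assumes \<omega>: "\<omega> \<in> space M" and t: "real m \<le> t" "t < real m + 1" and "X t \<omega> \<in> A"
  shows "\<exists>l. \<omega> \<in> grid_visit m l A"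
proof -
  have "\<forall>\<^sub>F s in at_right t. X s \<omega> = X t \<omega>"
    using rcll[OF \<omega>] t by (auto simp: rcll_path_def)
  then obtain b where b: "b > t" "\<And>s. t < s \<Longrightarrow> s < b \<Longrightarrow> X s \<omega> = X t \<omega>"
    by (auto simp: eventually_at_right_field)
  \<comment> \<open>The second bound keeps the dyadic time below \<open>m + 1\<close>.\<close>
  define d where "d = min (b - t) (real m + 1 - t)"
  have "0 < d" using b t by (simp add: d_def)
  then obtain l where l: "(1 / 2) ^ l < d"
    using real_arch_pow_inv[of d "1 / 2"] by auto
  \<comment> \<open>Rounding up puts the grid point to the right of \<open>t\<close>, or at
    \<open>t\<close>, at distance less than the mesh.\<close>
  define k where "k = nat \<lceil>(t - m) * 2 ^ l\<rceil>"
  have "0 \<le> (t - m) * 2 ^ l" using t by simp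
  then have "(t - m) * 2 ^ l \<le> k" "k < (t - m) * 2 ^ l + 1"
    unfolding k_def by linarith+
  then have "t - m \<le> k / 2 ^ l" "k / 2 ^ l < (t - m) + (1 / 2) ^ l"
    by (simp_all add: pos_le_divide_eq pos_divide_less_eq power_one_over distrib_right)
  then have s: "t \<le> m + k / 2 ^ l" "m + k / 2 ^ l < t + (1 / 2) ^ l" by simp_all
  then have X: "X (m + k / 2 ^ l) \<omega> = X t \<omega>"
    using b(2)[of "m + k / 2 ^ l"] l by (cases "t = m + k / 2 ^ l") (auto simp: d_def)
  have "(1 / 2) ^ l < real m + 1 - t" using l by (simp add: d_def)
  then have "k / 2 ^ l < (1::real)" using s(2) by linarith
  then have "k < 2 ^ l" by simp
  then show ?thesis using \<omega> \<open>X t \<omega> \<in> A\<close> X by (intro exI[of _ l]) auto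
qed

text \<open>The dyadic grids are nested, so their visit events increase with \<open>l\<close>. The
  grid estimate has the factor \<open>exp (c + 1)\<close> for every mesh and therefore passes to the
  limit.\<close>

lemma prob_unit_interval_visit_le:
  "prob (\<Union>l. grid_visit m l A) \<le> exp (c + 1) * prob {\<omega> \<in> space M. X (real m + 1) \<omega> \<in> A}"
proof (rule LIMSEQ_le_const2)
  have "incseq (\<lambda>l. grid_visit m l A)"
  proof (rule incseq_SucI, safe)
    fix l \<omega> k assume "k < (2::nat) ^ l" and X: "X (real m + real k / 2 ^ l) \<omega> \<in> A"
    then have "2 * k < 2 ^ Suc l" by simp
    moreover have "X (real m + real (2 * k) / 2 ^ Suc l) \<omega> \<in> A" using X by simp
    ultimately show "\<exists>k<2 ^ Suc l. X (real m + real k / 2 ^ Suc l) \<omega> \<in> A" by blast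
  qed
  then show "(\<lambda>l. prob (grid_visit m l A)) \<longlonglongrightarrow> prob (\<Union>l. grid_visit m l A)"
    by (intro finite_Lim_measure_incseq) (use grid_visit_in_sets in auto)
  have "prob (grid_visit m l A) \<le> exp (c + 1) * prob {\<omega> \<in> space M. X (real m + 1) \<omega> \<in> A}" for l
  proof -
    let ?t = "\<lambda>k. real m + real k / 2 ^ l" and ?n = "2 ^ l - 1 :: nat"
    have n: "k < 2 ^ l \<longleftrightarrow> k \<le> ?n" for k :: nat
      by (metis Suc_pred' less_Suc_eq_le zero_less_numeral zero_less_power)
    have "?t ?n \<le> real m + 1" by (simp add: of_nat_diff divide_le_eq)
    then have "exp (- (c + 1) * (real m + 1 - ?t 0)) * prob {\<omega> \<in> space M. \<exists>k\<le>?n. X (?t k) \<omega> \<in> A} \<le>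
        prob {\<omega> \<in> space M. X (real m + 1) \<omega> \<in> A}"
      by (intro prob_grid_visit_le) (auto simp: divide_simps)
    then have "exp (c + 1) * (exp (- (c + 1)) * prob {\<omega> \<in> space M. \<exists>k\<le>?n. X (?t k) \<omega> \<in> A}) \<le>
        exp (c + 1) * prob {\<omega> \<in> space M. X (real m + 1) \<omega> \<in> A}"
      by (intro mult_left_mono) auto
    then show ?thesis
      unfolding n mult.assoc[symmetric] exp_add[symmetric] by simp
  qed
  then show "\<exists>N. \<forall>l\<ge>N. prob (grid_visit m l A) \<le> exp (c + 1) * prob {\<omega> \<in> space M. X (real m + 1) \<omega> \<in> A}"
    by blast
qed

lemma eventually_avoids:
  assumes "summable (\<lambda>m. prob {\<omega> \<in> space M. X (real m) \<omega> \<in> A})"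
  shows "prob {\<omega> \<in> space M. \<exists>s\<ge>0. \<forall>t\<ge>s. X t \<omega> \<notin> A} = 1"
proof -
  define F where "F m = (\<Union>l. grid_visit m l A)" for m
  have F: "F m \<in> events" for m unfolding F_def using grid_visit_in_sets by auto
  \<comment> \<open>The shift by one is due to visits during \<open>[m, m + 1)\<close> being charged
    to time \<open>m + 1\<close>.\<close>
  have "summable (\<lambda>m. prob {\<omega> \<in> space M. X (real (Suc m)) \<omega> \<in> A})"
    using summable_Suc_iff[of "\<lambda>m. prob {\<omega> \<in> space M. X (real m) \<omega> \<in> A}"] assms by simp
  then have "summable (\<lambda>m. exp (c + 1) * prob {\<omega> \<in> space M. X (real m + 1) \<omega> \<in> A})"
    by (intro summable_mult) (simp add: add.commute)
  then have "summable (\<lambda>m. prob (F m))"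
    by (rule summable_comparison_test') (use prob_unit_interval_visit_le in \<open>simp add: F_def\<close>)
  then have ae: "AE \<omega> in M. \<forall>\<^sub>F m in sequentially. \<omega> \<in> space M - F m"
    using F by (intro borel_cantelli_AE1) (auto simp: less_top[symmetric])
  \<comment> \<open>The event quantifies over uncountably many times. This equivalence gives its
    measurability as well as its link to Borel-Cantelli.\<close>
  have iff: "(\<exists>s\<ge>0. \<forall>t\<ge>s. X t \<omega> \<notin> A) \<longleftrightarrow> (\<exists>n. \<forall>m\<ge>n. \<omega> \<in> space M - F m)" if \<omega>: "\<omega> \<in> space M" for \<omega>
  proof
    assume "\<exists>s\<ge>0. \<forall>t\<ge>s. X t \<omega> \<notin> A"
    then obtain s where s: "\<And>t. t \<ge> s \<Longrightarrow> X t \<omega> \<notin> A" by auto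
    obtain n :: nat where n: "s \<le> n" using real_arch_simple by blast
    have "\<omega> \<notin> grid_visit m l A" if "n \<le> m" for m l
    proof -
      have "s \<le> real m + real k / 2 ^ l" for k :: nat
        using n that by (intro add_increasing2) auto
      then show ?thesis using s by blast
    qed
    then show "\<exists>n. \<forall>m\<ge>n. \<omega> \<in> space M - F m" using \<omega> unfolding F_def by blast
  next
    assume "\<exists>n. \<forall>m\<ge>n. \<omega> \<in> space M - F m"
    then obtain n where n: "\<And>m. m \<ge> n \<Longrightarrow> \<omega> \<notin> F m" by blast
    have "X t \<omega> \<notin> A" if t: "t \<ge> real n" for t
    proof
      assume "X t \<omega> \<in> A"
      moreover have "real (nat \<lfloor>t\<rfloor>) \<le> t" "t < real (nat \<lfloor>t\<rfloor>) + 1" "n \<le> nat \<lfloor>t\<rfloor>"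
        using t by linarith+
      ultimately show False using visit_imp_grid_visit[OF \<omega>, of "nat \<lfloor>t\<rfloor>" t A] n unfolding F_def by blast
    qed
    then show "\<exists>s\<ge>0. \<forall>t\<ge>s. X t \<omega> \<notin> A" by (intro exI[of _ "real n"]) auto
  qed
  have eq: "{\<omega> \<in> space M. \<exists>s\<ge>0. \<forall>t\<ge>s. X t \<omega> \<notin> A} = (\<Union>n. \<Inter>m\<in>{n..}. space M - F m)"
    by (rule set_eqI) (use iff in \<open>simp add: Ball_def, blast\<close>)
  have meas: "{\<omega> \<in> space M. \<exists>s\<ge>0. \<forall>t\<ge>s. X t \<omega> \<notin> A} \<in> events"
    unfolding eq using F by (intro sets.countable_UN sets.countable_INT'') auto
  have "AE \<omega> in M. \<exists>s\<ge>0. \<forall>t\<ge>s. X t \<omega> \<notin> A"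
    using ae AE_space
  proof eventually_elim
    case (elim \<omega>)
    then show ?case unfolding iff[OF elim(2)] by (simp add: eventually_sequentially)
  qed
  then show ?thesis using prob_Collect_eq_1[OF meas] by simp
qed

text \<open>The occupation bound does not depend on the initial state, so it survives averaging over
  the law of \<open>X 0\<close> and yields summability.\<close>

lemma eventually_avoids_of_drift:
  assumes f: "\<And>y. 0 \<le> f y" "\<And>y. f y \<le> b" and "0 < d"
    and drift: "\<And>y. drift f y \<le> - d * indicator A y"
  shows "prob {\<omega> \<in> space M. \<exists>s\<ge>0. \<forall>t\<ge>s. X t \<omega> \<notin> A} = 1"
proof (rule eventually_avoids)
  let ?C = "b * exp (c + 1) / d"
  have le: "(\<Sum>m<n. measure_pmf.prob (p (real m) x) A) \<le> ?C" for n x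
    using occupation_sum_le[OF f less_imp_le[OF \<open>0 < d\<close>] drift, where n = n and x = x] \<open>0 < d\<close>
    by (simp add: exp_minus pos_le_divide_eq inverse_eq_divide pos_divide_le_eq mult_ac del: minus_add_distrib)
  have "(\<Sum>m<n. prob {\<omega> \<in> space M. X (real m) \<omega> \<in> A}) \<le> ?C * 1" for n
  proof (rule has_sum_mono)
    show "((\<lambda>x. \<Sum>m<n. prob {\<omega> \<in> space M. X 0 \<omega> = x} * measure_pmf.prob (p (real m) x) A) has_sum
        (\<Sum>m<n. prob {\<omega> \<in> space M. X (real m) \<omega> \<in> A})) UNIV"
      by (intro has_sum_finite_sum has_sum_prob_initial) auto
    show "((\<lambda>x. ?C * prob {\<omega> \<in> space M. X 0 \<omega> = x}) has_sum ?C * 1) UNIV"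
      by (intro has_sum_cmult_right has_sum_prob_initial_1)
    show "(\<Sum>m<n. prob {\<omega> \<in> space M. X 0 \<omega> = x} * measure_pmf.prob (p (real m) x) A) \<le>
        ?C * prob {\<omega> \<in> space M. X 0 \<omega> = x}" for x
      using mult_left_mono[OF le[of x n], of "prob {\<omega> \<in> space M. X 0 \<omega> = x}"]
      unfolding sum_distrib_left[symmetric] by (simp add: mult.commute)
  qed
  then show "summable (\<lambda>m. prob {\<omega> \<in> space M. X (real m) \<omega> \<in> A})"
    by (intro summableI_nonneg_bounded[of _ "?C * 1"]) auto
qed

text \<open>The level \<open>n\<close> may depend on the initial state \<open>x\<close>. Finitely
  many initial states carry all but \<open>e / 2\<close> of the mass, and the largest of their
  levels for \<open>e / 2\<close> serves them all.\<close>

lemma uniformly_tight: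
  assumes tight: "\<And>x e. e > 0 \<Longrightarrow> \<exists>n::nat. \<forall>t\<ge>0. measure_pmf.prob (p t x) {y. n \<le> N y} \<le> e"
    and "e > 0"
  shows "\<exists>n. \<forall>t\<ge>0. prob {\<omega> \<in> space M. n \<le> N (X t \<omega>)} \<le> e"
proof -
  let ?P = "\<lambda>x. prob {\<omega> \<in> space M. X 0 \<omega> = x}"
  have "\<forall>\<^sub>F F in finite_subsets_at_top UNIV. 1 - e / 2 < sum ?P F"
    using has_sum_prob_initial_1 \<open>e > 0\<close> unfolding has_sum_def by (intro order_tendstoD) auto
  then obtain F where F: "finite F" "1 - e / 2 < sum ?P F"
    by (auto simp: eventually_finite_subsets_at_top)
  have "\<forall>x. \<exists>n::nat. \<forall>t\<ge>0. measure_pmf.prob (p t x) {y. n \<le> N y} \<le> e / 2"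
    by (intro allI tight) (use \<open>e > 0\<close> in simp)
  then obtain n where n: "\<And>x t. 0 \<le> t \<Longrightarrow> measure_pmf.prob (p t x) {y. n x \<le> N y} \<le> e / 2"
    by metis
  \<comment> \<open>The inserted \<open>0\<close> covers an empty \<open>F\<close>, which is
    possible for large \<open>e\<close>.\<close>
  define k where "k = Max (insert 0 (n ` F))"
  have k: "measure_pmf.prob (p t x) {y. k \<le> N y} \<le> e / 2" if "x \<in> F" "0 \<le> t" for x t
  proof -
    have "n x \<le> k" using that F(1) by (auto simp: k_def)
    then have "measure_pmf.prob (p t x) {y. k \<le> N y} \<le> measure_pmf.prob (p t x) {y. n x \<le> N y}"
      by (intro measure_pmf.finite_measure_mono) auto
    then show ?thesis using n[OF that(2), of x] by simp
  qed
  have "prob {\<omega> \<in> space M. k \<le> N (X t \<omega>)} \<le> e" if t: "0 \<le> t" for t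
  proof -
    have "prob {\<omega> \<in> space M. X t \<omega> \<in> {y. k \<le> N y}} \<le> (1 + - sum ?P F) + e / 2 * 1"
    proof (rule has_sum_mono)
      show "((\<lambda>x. ?P x * measure_pmf.prob (p t x) {y. k \<le> N y}) has_sum
          prob {\<omega> \<in> space M. X t \<omega> \<in> {y. k \<le> N y}}) UNIV"
        by (rule has_sum_prob_initial[OF t])
      have "((\<lambda>x. if x \<in> F then ?P x else 0) has_sum sum ?P F) UNIV"
        by (rule has_sum_finite_neutralI) (use F in auto)
      then show "((\<lambda>x. (?P x + - (if x \<in> F then ?P x else 0)) + e / 2 * ?P x) has_sum
          (1 + - sum ?P F) + e / 2 * 1) UNIV"
        by (intro has_sum_add has_sum_uminusI has_sum_cmult_right has_sum_prob_initial_1)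
      show "?P x * measure_pmf.prob (p t x) {y. k \<le> N y} \<le>
          (?P x + - (if x \<in> F then ?P x else 0)) + e / 2 * ?P x" for x
      proof (cases "x \<in> F")
        case True
        then show ?thesis using mult_left_mono[OF k[OF True t], of "?P x"] by (simp add: mult.commute)
      next
        case False
        then show ?thesis
          using mult_left_le[of "measure_pmf.prob (p t x) {y. k \<le> N y}" "?P x"] \<open>e > 0\<close>
          by (simp add: add_increasing2)
      qed
    qed
    then show ?thesis using F(2) by simp
  qed
  then show ?thesis by blast
qed

end

section \<open>Queue length processes\<close>

locale queue =
  fixes lam :: "'n::finite \<Rightarrow> real" and \<phi> :: "'n \<Rightarrow> ('n \<Rightarrow> nat) \<Rightarrow> real"
  assumes lam_pos: "0 < lam i" and phi_nonneg: "0 \<le> \<phi> i x" and phi_bounded: "bounded (range (\<phi> i))"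
begin

text \<open>Without the restriction to \<open>0 < x i\<close>, truncated subtraction would make
  \<open>x\<close> a neighbour of itself.\<close>

definition neighbours :: "('n \<Rightarrow> nat) \<Rightarrow> ('n \<Rightarrow> nat) set" where
  "neighbours x = range (\<lambda>i. x(i := Suc (x i))) \<union> (\<lambda>i. x(i := x i - 1)) ` {i. 0 < x i}"

definition phi_bound :: "'n \<Rightarrow> real" where
  "phi_bound i = (SOME b. \<forall>x. \<phi> i x \<le> b)"

lemma phi_le_bound: "\<phi> i x \<le> phi_bound i"
proof -
  obtain b where "\<forall>x. \<phi> i x \<le> b"
    using phi_bounded[of i] by (auto simp: bounded_iff dest: abs_le_D1)
  then have "\<forall>x. \<phi> i x \<le> phi_bound i" unfolding phi_bound_def by (rule someI)
  then show ?thesis ..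
qed

lemma phi_bound_nonneg: "0 \<le> phi_bound i"
  using phi_nonneg phi_le_bound by (rule order_trans)

lemma finite_neighbours: "finite (neighbours x)"
  by (simp add: neighbours_def)

lemma not_in_neighbours: "x \<notin> neighbours x"
  by (auto simp: neighbours_def fun_upd_idem_iff eq_commute[of x])

lemma queue_rate_nonneg: "0 \<le> queue_rate lam \<phi> x y"
  unfolding queue_rate_def using lam_pos phi_nonneg by (intro sum_nonneg) (auto intro!: add_nonneg_nonneg less_imp_le[of 0 "lam _"])

lemma queue_rate_outside: "y \<notin> neighbours x \<Longrightarrow> queue_rate lam \<phi> x y = 0"
  unfolding queue_rate_def by (intro sum.neutral) (auto simp: neighbours_def)

text \<open>After exchanging the sums, each \<open>i\<close> selects its own two targets. The weight
  \<open>g\<close> is kept general to serve both the total rate and the drift.\<close>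

lemma sum_queue_rate:
  "(\<Sum>y\<in>neighbours x. queue_rate lam \<phi> x y * g y) =
    (\<Sum>i\<in>UNIV. lam i * g (x(i := Suc (x i))) + (if 0 < x i then \<phi> i x * g (x(i := x i - 1)) else 0))"
proof -
  have "(\<Sum>y\<in>neighbours x. queue_rate lam \<phi> x y * g y) =
      (\<Sum>i\<in>UNIV. \<Sum>y\<in>neighbours x. ((if y = x(i := Suc (x i)) then lam i else 0)
        + (if 0 < x i \<and> y = x(i := x i - 1) then \<phi> i x else 0)) * g y)"
    unfolding queue_rate_def sum_distrib_right by (rule sum.swap)
  also have "\<dots> = (\<Sum>i\<in>UNIV. lam i * g (x(i := Suc (x i)))
      + (if 0 < x i then \<phi> i x * g (x(i := x i - 1)) else 0))"
  proof (rule sum.cong)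
    fix i
    have "(\<Sum>y\<in>neighbours x. (if y = x(i := Suc (x i)) then lam i else 0) * g y) =
        lam i * g (x(i := Suc (x i)))"
    proof -
      have "x(i := Suc (x i)) \<in> neighbours x" by (auto simp: neighbours_def)
      then show ?thesis
        by (simp add: if_distrib[of "\<lambda>a. a * _"] sum.delta finite_neighbours cong: if_cong)
    qed
    moreover have "(\<Sum>y\<in>neighbours x. (if 0 < x i \<and> y = x(i := x i - 1) then \<phi> i x else 0) * g y) =
        (if 0 < x i then \<phi> i x * g (x(i := x i - 1)) else 0)"
    proof (cases "0 < x i")
      case True
      then have "x(i := x i - 1) \<in> neighbours x" by (auto simp: neighbours_def)
      then show ?thesis
        using True by (simp add: if_distrib[of "\<lambda>a. a * _"] sum.delta finite_neighbours cong: if_cong)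
    qed simp
    ultimately show "(\<Sum>y\<in>neighbours x. ((if y = x(i := Suc (x i)) then lam i else 0)
        + (if 0 < x i \<and> y = x(i := x i - 1) then \<phi> i x else 0)) * g y) =
      lam i * g (x(i := Suc (x i))) + (if 0 < x i then \<phi> i x * g (x(i := x i - 1)) else 0)"
      by (simp only: distrib_right sum.distrib)
  qed simp
  finally show ?thesis .
qed

lemma total_queue_rate_le:
  "(\<Sum>y\<in>neighbours x. queue_rate lam \<phi> x y) \<le> (\<Sum>i\<in>UNIV. lam i + phi_bound i)"
proof -
  have "(\<Sum>y\<in>neighbours x. queue_rate lam \<phi> x y) =
      (\<Sum>i\<in>UNIV. lam i + (if 0 < x i then \<phi> i x else 0))"
    using sum_queue_rate[of x "\<lambda>_. 1"] by (simp cong: if_cong)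
  also have "\<dots> \<le> (\<Sum>i\<in>UNIV. lam i + phi_bound i)"
    using phi_le_bound phi_bound_nonneg by (intro sum_mono) auto
  finally show ?thesis .
qed

end

locale queue_process = queue lam \<phi> + prob_space M
  for lam :: "'n::finite \<Rightarrow> real" and \<phi> and M :: "'w measure" +
  fixes p :: "real \<Rightarrow> ('n \<Rightarrow> nat) \<Rightarrow> ('n \<Rightarrow> nat) pmf" and X :: "real \<Rightarrow> 'w \<Rightarrow> ('n \<Rightarrow> nat)"
  assumes semigroup: "transition_semigroup p"
    and gen: "has_generator p (generator (queue_rate lam \<phi>))"
    and X_measurable: "0 \<le> t \<Longrightarrow> X t \<in> measurable M (count_space UNIV)"
    and rcll: "\<omega> \<in> space M \<Longrightarrow> rcll_path (\<lambda>t. X t \<omega>)"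
    and markov: "markov_with M p X"

sublocale queue_process \<subseteq> rcll_markov_process M p "queue_rate lam \<phi>" neighbours
    "\<Sum>i\<in>UNIV. lam i + phi_bound i" X
  by unfold_locales
    (use semigroup gen X_measurable rcll markov finite_neighbours not_in_neighbours
      queue_rate_outside queue_rate_nonneg total_queue_rate_le in auto)

section \<open>Lyapunov functions of a single coordinate\<close>

context queue_process
begin

text \<open>Transitions of the other coordinates leave the function unchanged.\<close>

lemma drift_coordinate:
  fixes F :: "nat \<Rightarrow> real"
  shows "drift (\<lambda>y. F (y i)) x =
    lam i * (F (Suc (x i)) - F (x i)) + (if 0 < x i then \<phi> i x * (F (x i - 1) - F (x i)) else 0)"
proof -
  have "drift (\<lambda>y. F (y i)) x = (\<Sum>j\<in>UNIV. if j = i then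
      lam i * (F (Suc (x i)) - F (x i)) + (if 0 < x i then \<phi> i x * (F (x i - 1) - F (x i)) else 0) else 0)"
    unfolding drift_def sum_queue_rate by (rule sum.cong) auto
  then show ?thesis by simp
qed

text \<open>A service cannot raise the function; an arrival multiplies it by \<open>w\<close> below
  the cutoff and leaves it unchanged from there on.\<close>

lemma drift_truncated_power_le:
  fixes w :: real
  assumes "1 < w"
  shows "drift (\<lambda>y. w ^ min (y i) m) x \<le> lam i * (w - 1) * w ^ min (x i) m"
proof -
  have up: "w ^ min (Suc (x i)) m - w ^ min (x i) m \<le> (w - 1) * w ^ min (x i) m"
    using assms by (cases "x i < m") (auto simp: min_def algebra_simps)
  have "w ^ min (x i - 1) m \<le> w ^ min (x i) m"
    using assms by (intro power_increasing) auto
  then have "\<phi> i x * (w ^ min (x i - 1) m - w ^ min (x i) m) \<le> 0"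
    using phi_nonneg[of i x] by (intro mult_nonneg_nonpos) auto
  moreover have "lam i * (w ^ min (Suc (x i)) m - w ^ min (x i) m) \<le> lam i * ((w - 1) * w ^ min (x i) m)"
    using lam_pos[of i] up by (intro mult_left_mono) auto
  ultimately show ?thesis unfolding drift_coordinate[of "\<lambda>n. w ^ min n m"] by (auto simp: mult.assoc)
qed

text \<open>The bound grows with \<open>t\<close> but is free of \<open>m\<close>. With
  \<open>w = z\<^sup>2\<close> it controls the error of the cutoff.\<close>

lemma E_truncated_power_le:
  fixes w :: real
  assumes "1 < w" "0 \<le> t"
  shows "E t x (\<lambda>y. w ^ min (y i) m) \<le> exp (lam i * (w - 1) * t) * w ^ x i"
proof -
  have "E t x (\<lambda>y. w ^ min (y i) m) \<le> exp (lam i * (w - 1) * t) * w ^ min (x i) m"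
    using drift_gronwall[of "\<lambda>y. w ^ min (y i) m" "w ^ m" "\<lambda>_. 0" 0 t "lam i * (w - 1)" 0 x 0]
      drift_truncated_power_le[OF assms(1), of i m] assms lam_pos[of i]
    by (auto simp: power_increasing)
  also have "\<dots> \<le> exp (lam i * (w - 1) * t) * w ^ x i"
    using assms by (intro mult_left_mono power_increasing) auto
  finally show ?thesis .
qed

text \<open>The truncated function has no negative drift at level \<open>m\<close> and above. There the term with
  \<open>z\<^sup>2\<close> makes up for it, and its expectation is of order \<open>1 / z ^ m\<close>, uniformly on bounded
  time intervals.\<close>

lemma drift_truncated_power_le_stable:
  fixes z :: real
  assumes z: "1 < z" and \<theta>: "lam i < \<theta> / z" "\<And>x. n0 \<le> x i \<Longrightarrow> \<theta> \<le> \<phi> i x"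
    and \<delta>: "\<delta> = (z - 1) * (\<theta> / z - lam i)"
  shows "drift (\<lambda>y. z ^ min (y i) m) x \<le>
    (lam i * (z - 1) + \<delta>) * z ^ n0 + - \<delta> * z ^ min (x i) m + \<delta> / z ^ m * (z\<^sup>2) ^ min (x i) m"
proof -
  have pos: "0 < \<delta>" "0 < z" "0 < lam i" using z \<theta> lam_pos by (auto simp: \<delta>)
  have nonneg: "0 \<le> \<delta> / z ^ m * (z\<^sup>2) ^ min (x i) m" "0 \<le> (lam i * (z - 1) + \<delta>) * z ^ n0"
    using pos z by auto
  consider "m \<le> x i" | "x i < m" "x i \<le> n0" | "x i < m" "n0 < x i" by linarith
  then show ?thesis
  proof cases
    case 1
    have "drift (\<lambda>y. z ^ min (y i) m) x \<le> 0"
    proof -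
      have "z ^ min (x i - 1) m \<le> z ^ m" using z by (intro power_increasing) auto
      then show ?thesis unfolding drift_coordinate[of "\<lambda>n. z ^ min n m"]
        using 1 phi_nonneg[of i x] by (auto simp: min_absorb2 intro: mult_nonneg_nonpos)
    qed
    \<comment> \<open>At the cutoff the term with \<open>z\<^sup>2\<close> cancels the negative term
      exactly.\<close>
    moreover have "\<delta> / z ^ m * (z\<^sup>2) ^ min (x i) m = \<delta> * z ^ min (x i) m"
      using 1 pos by (simp add: min_absorb2 power2_eq_square power_mult_distrib)
    ultimately show ?thesis using nonneg(2) by simp
  next
    case 2
    \<comment> \<open>Up to level \<open>n0\<close> the service rate has no useful lower bound; the
      constant absorbs both the growth from arrivals and the term with
      \<open>- \<delta>\<close>.\<close>
    have "z ^ min (x i) m \<le> z ^ n0" using 2 z by (intro power_increasing) auto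
    then have "(lam i * (z - 1) + \<delta>) * z ^ min (x i) m \<le> (lam i * (z - 1) + \<delta>) * z ^ n0"
      using pos z by (intro mult_left_mono) auto
    then show ?thesis
      using drift_truncated_power_le[OF z, of i m x] nonneg(1) by (simp add: distrib_right)
  next
    case 3
    then obtain k where k: "x i = Suc k" by (cases "x i") auto
    have "drift (\<lambda>y. z ^ min (y i) m) x = (z - 1) * z ^ k * (lam i * z - \<phi> i x)"
      unfolding drift_coordinate[of "\<lambda>n. z ^ min n m"] using 3 k by (simp add: min_def algebra_simps)
    also have "\<dots> \<le> (z - 1) * z ^ k * (lam i * z - \<theta>)"
      using \<theta>(2)[of x] 3 z by (intro mult_left_mono) auto
    \<comment> \<open>This is the origin of \<open>\<delta>\<close>: since
      \<open>x i = Suc k\<close>, one factor \<open>z\<close> is taken out of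
      \<open>lam i * z - \<theta>\<close>.\<close>
    also have "\<dots> = - \<delta> * z ^ min (x i) m"
      using 3 k pos by (simp add: \<delta> min_def field_simps)
    finally show ?thesis using nonneg by linarith
  qed
qed

text \<open>Markov's inequality for the cut-off power. At fixed \<open>t\<close>, letting
  \<open>m\<close> tend to infinity removes the error and leaves \<open>L\<close>, which does not
  depend on \<open>t\<close>.\<close>

lemma coordinate_tight:
  assumes \<theta>: "lam i < \<theta>" "\<And>x. n0 \<le> x i \<Longrightarrow> \<theta> \<le> \<phi> i x" and "e > 0"
  shows "\<exists>k. \<forall>t\<ge>0. measure_pmf.prob (p t x) {y. k \<le> y i} \<le> e"
proof -
  \<comment> \<open>The midpoint of \<open>1\<close> and \<open>\<theta> / lam i\<close>, so that
    \<open>z > 1\<close> and still \<open>lam i < \<theta> / z\<close>.\<close>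
  define z where "z = (lam i + \<theta>) / (2 * lam i)"
  have lam: "0 < lam i" by (rule lam_pos)
  have z: "1 < z" using \<theta>(1) lam by (simp add: z_def field_simps)
  have "z * (2 * lam i) = lam i + \<theta>" using lam by (simp add: z_def)
  then have \<theta>z: "lam i < \<theta> / z" using z \<theta>(1) by (simp add: pos_less_divide_eq mult_ac)
  define \<delta> where "\<delta> = (z - 1) * (\<theta> / z - lam i)"
  have \<delta>: "0 < \<delta>" using z \<theta>z by (simp add: \<delta>_def)
  define B where "B = (lam i * (z - 1) + \<delta>) * z ^ n0"
  have B: "0 \<le> B" using lam z \<delta> by (simp add: B_def)
  \<comment> \<open>The initial value plus the level \<open>B / \<delta>\<close> at which the
    constant and the decay balance.\<close>
  define L where "L = z ^ x i + B / \<delta>"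
  have z2: "1 < z\<^sup>2" using z by (simp add: one_less_power)
  have le: "z ^ k * measure_pmf.prob (p t x) {y. k \<le> y i} \<le> L" if t: "0 \<le> t" for t k
  proof (rule LIMSEQ_le_const)
    \<comment> \<open>A bound for the expectation of the cut-off power of \<open>z\<^sup>2\<close>
      up to time \<open>t\<close>; it is free of \<open>m\<close>, so division by
      \<open>z ^ m\<close> makes it vanish.\<close>
    let ?R = "exp (lam i * (z\<^sup>2 - 1) * t) * (z\<^sup>2) ^ x i"
    have "(\<lambda>m. ?R * inverse (z ^ m)) \<longlonglongrightarrow> ?R * 0"
      by (intro tendsto_intros LIMSEQ_inverse_realpow_zero z)
    then show "(\<lambda>m. L + ?R * inverse (z ^ m)) \<longlonglongrightarrow> L" by (auto intro: tendsto_eq_intros)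
    have "z ^ k * measure_pmf.prob (p t x) {y. k \<le> y i} \<le> L + ?R * inverse (z ^ m)" if m: "k \<le> m" for m
    proof -
      define V where "V y = z ^ min (y i) m" for y :: "'n \<Rightarrow> nat"
      define g where "g y = \<delta> / z ^ m * (z\<^sup>2) ^ min (y i) m" for y :: "'n \<Rightarrow> nat"
      have V: "\<bar>V y\<bar> \<le> z ^ m" for y using z by (simp add: V_def power_increasing)
      have g: "\<bar>g y\<bar> \<le> \<delta> / z ^ m * (z\<^sup>2) ^ m" for y
        using z z2 \<delta> by (auto simp: g_def abs_mult intro!: divide_right_mono mult_left_mono power_increasing)
      have drift: "drift V y \<le> B + - \<delta> * V y + g y" for y
        unfolding V_def g_def B_def using z \<theta>z \<theta>(2) \<delta>_def by (rule drift_truncated_power_le_stable)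
      have Eg: "E s x g \<le> \<delta> / z ^ m * ?R" if "0 \<le> s" "s < t" for s
      proof -
        have "E s x (\<lambda>y. (z\<^sup>2) ^ min (y i) m) \<le> exp (lam i * (z\<^sup>2 - 1) * s) * (z\<^sup>2) ^ x i"
          using z2 that by (intro E_truncated_power_le) auto
        also have "\<dots> \<le> ?R"
          using that lam z2 by (intro mult_right_mono) (auto intro: mult_left_mono)
        finally show ?thesis
          unfolding g_def using z \<delta> by (simp add: divide_right_mono mult_left_mono)
      qed
      define D where "D = B + \<delta> / z ^ m * ?R"
      have D: "0 \<le> D" using B \<delta> z by (simp add: D_def)
      have "E t x V + D / - \<delta> \<le> exp (- \<delta> * t) * (V x + D / - \<delta>)"
        unfolding D_def by (rule drift_gronwall[OF V g t _ drift Eg]) (use \<delta> in auto)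
      also have "\<dots> \<le> exp (- \<delta> * t) * V x"
        using D \<delta> by (intro mult_left_mono) auto
      also have "\<dots> \<le> z ^ x i"
      proof -
        have "V x \<le> z ^ x i" unfolding V_def using z by (intro power_increasing) auto
        moreover have "exp (- \<delta> * t) \<le> 1" using \<delta> t by simp
        ultimately have "exp (- \<delta> * t) * V x \<le> 1 * z ^ x i"
          using z by (intro mult_mono) (auto simp: V_def)
        then show ?thesis by simp
      qed
      finally have "E t x V \<le> z ^ x i + D / \<delta>" by simp
      also have "\<dots> = L + ?R * inverse (z ^ m)"
        using \<delta> z by (simp add: D_def L_def field_simps)
      finally have E: "E t x V \<le> L + ?R * inverse (z ^ m)" .
      have "z ^ k * measure_pmf.prob (p t x) {y. k \<le> y i} = E t x (\<lambda>y. z ^ k * indicator {y. k \<le> y i} y)"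
        by simp
      also have "\<dots> \<le> E t x V"
      proof (intro integral_mono pmf_integrable_bounded[OF V])
        show "integrable (p t x) (\<lambda>y. z ^ k * indicator {y. k \<le> y i} y)"
          by (rule pmf_integrable_bounded[of _ "z ^ k"]) (use z in \<open>auto split: split_indicator\<close>)
        show "z ^ k * indicator {y. k \<le> y i} y \<le> V y" for y
          using z m by (auto simp: V_def split: split_indicator intro: power_increasing)
      qed
      also note E
      finally show ?thesis .
    qed
    then show "\<exists>N. \<forall>m\<ge>N. z ^ k * measure_pmf.prob (p t x) {y. k \<le> y i} \<le> L + ?R * inverse (z ^ m)"
      by blast
  qed
  obtain k where k: "L / e < z ^ k" using real_arch_pow[OF z] by blast
  have "measure_pmf.prob (p t x) {y. k \<le> y i} \<le> e" if t: "0 \<le> t" for t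
  proof -
    have "z ^ k * measure_pmf.prob (p t x) {y. k \<le> y i} \<le> z ^ k * e"
      using le[OF t, of k] k \<open>e > 0\<close> by (simp add: pos_divide_less_eq)
    then show ?thesis using z by simp
  qed
  then show ?thesis by blast
qed

text \<open>The decreasing Lyapunov function \<open>F\<close> is the tail sum of \<open>d\<close>.
  Its drift at \<open>Suc n\<close> compares \<open>lam i * d (Suc n)\<close> with
  \<open>\<phi> i x * d n\<close>, so the ratio of successive \<open>d\<close> must exceed
  \<open>\<phi> i x / lam i\<close>: it is \<open>a\<close> below \<open>n0\<close>, where only the
  global bound on \<open>\<phi> i\<close> is available, and \<open>z < 1\<close> afterwards, which
  makes \<open>F\<close> finite.\<close>

lemma coordinate_transient:
  assumes \<theta>: "\<theta> < lam i" "\<And>x. n0 \<le> x i \<Longrightarrow> \<phi> i x \<le> \<theta>" and "finite K"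
  shows "prob {\<omega> \<in> space M. \<exists>s\<ge>0. \<forall>t\<ge>s. X t \<omega> i \<notin> K} = 1"
proof -
  \<comment> \<open>Any state at level \<open>n0\<close> shows this; it ensures that
    \<open>z\<close> is positive.\<close>
  have "0 \<le> \<theta>" using \<theta>(2)[of "\<lambda>_. n0"] phi_nonneg[of i "\<lambda>_. n0"] by simp
  have lam: "0 < lam i" by (rule lam_pos)
  \<comment> \<open>Chosen so that \<open>lam i * a\<close> exceeds every value of
    \<open>\<phi> i\<close> by at least \<open>lam i\<close>.\<close>
  define a where "a = phi_bound i / lam i + 1"
  \<comment> \<open>The midpoint of \<open>\<theta> / lam i\<close> and \<open>1\<close>.\<close>
  define z where "z = (\<theta> + lam i) / (2 * lam i)"
  define d where "d n = a ^ min n n0 * z ^ (n - n0)" for n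
  \<comment> \<open>The smaller of the two margins: \<open>lam i\<close> at \<open>0\<close> and in
    the range governed by \<open>a\<close>, and \<open>lam i * z - \<theta>\<close> above
    it.\<close>
  define \<epsilon> where "\<epsilon> = min (lam i) (lam i * z - \<theta>)"
  have a: "1 \<le> a" "lam i * a = phi_bound i + lam i"
    using phi_bound_nonneg[of i] lam by (auto simp: a_def field_simps)
  have z: "0 < z" "z < 1" "0 < lam i * z - \<theta>"
    using lam \<open>0 \<le> \<theta>\<close> \<theta>(1) by (auto simp: z_def field_simps)
  have \<epsilon>: "0 < \<epsilon>" using lam z by (simp add: \<epsilon>_def)
  have d_ge: "z ^ n \<le> d n" for n
  proof -
    have "1 * z ^ n \<le> a ^ min n n0 * z ^ (n - n0)"
      using a(1) z by (intro mult_mono one_le_power power_decreasing) auto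
    then show ?thesis by (simp add: d_def)
  qed
  have d_pos: "0 < d n" for n using a z by (simp add: d_def)
  have "summable (\<lambda>n. d (n + n0))"
  proof -
    have "d (n + n0) = a ^ n0 * z ^ n" for n by (simp add: d_def)
    then show ?thesis using z by (simp add: summable_mult summable_geometric)
  qed
  then have d_summable: "summable d" by (subst (asm) summable_iff_shift)
  define F where "F n = suminf d - (\<Sum>k<n. d k)" for n
  have F_Suc: "F (Suc n) - F n = - d n" for n by (simp add: F_def)
  have F_nonneg: "0 \<le> F n" for n
    using sum_le_suminf[OF d_summable, of "{..<n}"] d_pos by (simp add: F_def less_imp_le)
  have F_le: "F n \<le> suminf d" for n
    using d_pos by (simp add: F_def sum_nonneg less_imp_le)
  \<comment> \<open>For an empty queue truncated subtraction gives \<open>d 0\<close>, which matches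
    the drift \<open>- lam i * d 0\<close> there.\<close>
  have drift_le: "drift (\<lambda>y. F (y i)) x \<le> - \<epsilon> * d (x i - 1)" for x
  proof (cases "x i")
    case 0
    then show ?thesis
      unfolding drift_coordinate using F_Suc[of 0] d_pos[of 0] by (simp add: \<epsilon>_def mult_right_mono)
  next
    case (Suc n)
    have eq: "drift (\<lambda>y. F (y i)) x = - (lam i * d (Suc n) - \<phi> i x * d n)"
    proof -
      have "F m - F (Suc m) = d m" for m using F_Suc[of m] by simp
      then show ?thesis unfolding drift_coordinate using Suc by (simp add: F_Suc)
    qed
    show ?thesis
    proof (cases "n < n0")
      case True
      then have "d (Suc n) = a * d n" by (simp add: d_def)
      then have "lam i * d (Suc n) - \<phi> i x * d n = (lam i * a - \<phi> i x) * d n"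
        by (simp add: algebra_simps)
      also have "\<dots> \<ge> \<epsilon> * d n"
        using phi_le_bound[of i x] d_pos[of n] a(2) by (intro mult_right_mono) (auto simp: \<epsilon>_def)
      finally show ?thesis using eq Suc by simp
    next
      case False
      then have "d (Suc n) = z * d n" by (simp add: d_def Suc_diff_le)
      then have "lam i * d (Suc n) - \<phi> i x * d n = (lam i * z - \<phi> i x) * d n"
        by (simp add: algebra_simps)
      also have "\<dots> \<ge> \<epsilon> * d n"
        using \<theta>(2)[of x] Suc False d_pos[of n] by (intro mult_right_mono) (auto simp: \<epsilon>_def)
      finally show ?thesis using eq Suc by simp
    qed
  qed
  obtain k where k: "K \<subseteq> {..k}" using \<open>finite K\<close> finite_nat_iff_bounded_le by blast
  have "prob {\<omega> \<in> space M. \<exists>s\<ge>0. \<forall>t\<ge>s. X t \<omega> \<notin> {x. x i \<in> K}} = 1"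
  proof (rule eventually_avoids_of_drift[of "\<lambda>y. F (y i)"])
    show "0 < \<epsilon> * z ^ k" using \<epsilon> z by simp
    show "drift (\<lambda>y. F (y i)) x \<le> - (\<epsilon> * z ^ k) * indicator {x. x i \<in> K} x" for x
    proof (cases "x i \<in> K")
      case True
      then have "x i - 1 \<le> k" using k by auto
      then have "z ^ k \<le> d (x i - 1)"
        using d_ge[of "x i - 1"] z power_decreasing[of "x i - 1" k z] by linarith
      then have "\<epsilon> * z ^ k \<le> \<epsilon> * d (x i - 1)" using \<epsilon> by simp
      then show ?thesis using True drift_le[of x] by simp
    next
      case False
      have "0 \<le> \<epsilon> * d (x i - 1)" using \<epsilon> d_pos[of "x i - 1"] by simp
      then show ?thesis using False drift_le[of x] by simp
    qed
  qed (use F_nonneg F_le in auto)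
  then show ?thesis by simp
qed

section \<open>From limits of the service rates to stability and transience\<close>

lemma coordinate_uniformly_tight:
  assumes "ereal (lam i) < liminf (\<lambda>n. INF x\<in>{x. x i = n}. ereal (\<phi> i x))" and "e > 0"
  shows "\<exists>n. \<forall>t\<ge>0. prob {\<omega> \<in> space M. n \<le> X t \<omega> i} \<le> e"
proof -
  \<comment> \<open>The strict inequality leaves room for a real \<open>\<theta>\<close> that bounds
    \<open>\<phi> i x\<close> from below once \<open>x i\<close> is large, whatever the other
    coordinates are.\<close>
  obtain \<theta> where \<theta>: "ereal (lam i) < ereal \<theta>"
      "ereal \<theta> < liminf (\<lambda>n. INF x\<in>{x. x i = n}. ereal (\<phi> i x))"
    using ereal_dense2[OF assms(1)] by blast
  obtain n0 where n0: "\<And>n. n0 \<le> n \<Longrightarrow> ereal \<theta> < (INF x\<in>{x. x i = n}. ereal (\<phi> i x))"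
    using less_LiminfD[OF \<theta>(2)] by (auto simp: eventually_sequentially)
  have "\<theta> \<le> \<phi> i x" if "n0 \<le> x i" for x
  proof -
    have "(INF x\<in>{y. y i = x i}. ereal (\<phi> i x)) \<le> ereal (\<phi> i x)" by (rule INF_lower) simp
    then show ?thesis using n0[OF that] by (meson ereal_less_eq(3) less_imp_le order_trans)
  qed
  then show ?thesis
    using \<theta>(1) assms(2) by (intro uniformly_tight coordinate_tight) auto
qed

lemma coordinate_stable:
  assumes "ereal (lam i) < liminf (\<lambda>n. INF x\<in>{x. x i = n}. ereal (\<phi> i x))"
  shows "stable_process M (\<lambda>t \<omega>. X t \<omega> i)"
  unfolding stable_process_def
proof (intro allI impI)
  fix e :: real assume "e > 0"
  then obtain n where "\<forall>t\<ge>0. prob {\<omega> \<in> space M. n \<le> X t \<omega> i} \<le> e"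
    using coordinate_uniformly_tight[OF assms] by blast
  then show "\<exists>K. finite K \<and> (\<forall>t\<ge>0. prob {\<omega> \<in> space M. X t \<omega> i \<notin> K} \<le> e)"
    by (intro exI[of _ "{..<n}"]) (simp add: not_less)
qed

lemma coordinate_transient_process:
  assumes "limsup (\<lambda>n. SUP x\<in>{x. x i = n}. ereal (\<phi> i x)) < ereal (lam i)"
  shows "transient_process M (\<lambda>t \<omega>. X t \<omega> i)"
proof -
  obtain \<theta> where \<theta>: "limsup (\<lambda>n. SUP x\<in>{x. x i = n}. ereal (\<phi> i x)) < ereal \<theta>"
      "ereal \<theta> < ereal (lam i)"
    using ereal_dense2[OF assms(1)] by blast
  obtain n0 where n0: "\<And>n. n0 \<le> n \<Longrightarrow> (SUP x\<in>{x. x i = n}. ereal (\<phi> i x)) < ereal \<theta>"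
    using Limsup_lessD[OF \<theta>(1)] by (auto simp: eventually_sequentially)
  have "\<phi> i x \<le> \<theta>" if "n0 \<le> x i" for x
  proof -
    have "ereal (\<phi> i x) \<le> (SUP x\<in>{y. y i = x i}. ereal (\<phi> i x))" by (rule SUP_upper) simp
    then show ?thesis using n0[OF that] by (meson ereal_less_eq(3) less_imp_le order_trans)
  qed
  then show ?thesis
    unfolding transient_process_def using \<theta>(2) by (intro allI impI coordinate_transient) auto
qed

text \<open>A union bound over the coordinates, each given an equal share of \<open>e\<close>; the
  half-line form of the coordinate bounds makes the compact set a finite box.\<close>

lemma process_stable:
  assumes "\<And>i. ereal (lam i) < liminf (\<lambda>n. INF x\<in>{x. x i = n}. ereal (\<phi> i x))"
  shows "stable_process M X"
  unfolding stable_process_def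
proof (intro allI impI)
  fix e :: real assume "e > 0"
  then have "0 < e / CARD('n)" by simp
  then have "\<exists>n. \<forall>t\<ge>0. prob {\<omega> \<in> space M. n \<le> X t \<omega> i} \<le> e / CARD('n)" for i
    by (rule coordinate_uniformly_tight[OF assms])
  then obtain n where n: "\<And>i t. 0 \<le> t \<Longrightarrow> prob {\<omega> \<in> space M. n i \<le> X t \<omega> i} \<le> e / CARD('n)"
    by metis
  let ?K = "Pi\<^sub>E UNIV (\<lambda>i. {..<n i})"
  have "prob {\<omega> \<in> space M. X t \<omega> \<notin> ?K} \<le> e" if t: "0 \<le> t" for t
  proof -
    have "{\<omega> \<in> space M. X t \<omega> \<notin> ?K} = (\<Union>i. {\<omega> \<in> space M. n i \<le> X t \<omega> i})"
      by (auto simp: PiE_UNIV_domain Pi_iff not_less)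
    moreover have "prob (\<Union>i. {\<omega> \<in> space M. n i \<le> X t \<omega> i}) \<le> (\<Sum>i\<in>UNIV. prob {\<omega> \<in> space M. n i \<le> X t \<omega> i})"
      using X_in_sets[OF t, of "{x. n _ \<le> x _}"]
      by (intro finite_measure_subadditive_finite) auto
    moreover have "\<dots> \<le> (\<Sum>i\<in>(UNIV::'n set). e / CARD('n))"
      by (intro sum_mono n t)
    ultimately show ?thesis by simp
  qed
  moreover have "finite ?K" by (intro finite_PiE) auto
  ultimately show "\<exists>K. finite K \<and> (\<forall>t\<ge>0. prob {\<omega> \<in> space M. X t \<omega> \<notin> K} \<le> e)" by blast
qed

end

theorem theorem1:
  fixes M :: "'w measure"
    and lam :: "'n::finite \<Rightarrow> real"
    and \<phi> :: "'n \<Rightarrow> ('n \<Rightarrow> nat) \<Rightarrow> real"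
    and X :: "real \<Rightarrow> 'w \<Rightarrow> ('n \<Rightarrow> nat)"
  assumes "\<And>i. lam i > 0"
    and "\<And>i x. \<phi> i x \<ge> 0"
    and "\<And>i. bounded (range (\<phi> i))"
    and "queue_length_process M lam \<phi> X"
  shows "(\<forall>i. ereal (lam i) < liminf (\<lambda>n. INF x\<in>{x. x i = n}. ereal (\<phi> i x))
              \<longrightarrow> stable_process M (\<lambda>t \<omega>. X t \<omega> i)) \<and>
         (\<forall>i. ereal (lam i) > limsup (\<lambda>n. SUP x\<in>{x. x i = n}. ereal (\<phi> i x))
              \<longrightarrow> transient_process M (\<lambda>t \<omega>. X t \<omega> i)) \<and>
         ((\<forall>i. ereal (lam i) < liminf (\<lambda>n. INF x\<in>{x. x i = n}. ereal (\<phi> i x)))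
              \<longrightarrow> stable_process M X)"
proof -
  obtain p where p: "transition_semigroup p" "has_generator p (generator (queue_rate lam \<phi>))"
      "markov_with M p X"
    using assms(4) unfolding queue_length_process_def markov_jump_process_def by blast
  interpret prob_space M
    using assms(4) unfolding queue_length_process_def markov_jump_process_def by blast
  interpret queue_process lam \<phi> M p X
    using assms p unfolding queue_length_process_def markov_jump_process_def
    by unfold_locales auto
  show ?thesis
    using coordinate_stable coordinate_transient_process process_stable by blast
qed

end
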